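(* If $\nu>-1$ and $z\in\mathbb{C}$, then the following Hadamard factorization holds: $$2^{2\nu}z^{-2\nu-1}\,\Gamma(\nu+1)\Gamma(\nu+2)\left(J_{\nu+1}(z) I_{\nu}(z) + J_{\nu}(z)I_{\nu+1}(z)\right)=\prod_{n\geq 1}\left(1-\frac{z^4}{\gamma_{\nu,n}^4}\right),$$ where $\gamma_{\nu,n}$ is the $n$th positive zero of the function $z\mapsto J_{\nu+1}(z) I_{\nu}(z) + J_\nu(z)I_{\nu+1}(z)$. Moreover, the zeros $\gamma_{\nu,n}$ satisfy the interlacing inequalities $$j_{\nu,n}<\gamma_{\nu,n}<j_{\nu,n+1}\quad\text{and}\quad j_{\nu,n}<\gamma_{\nu,n}<j_{\nu+1,n}$$ for all $n\in\mathbb{N}$ and $\nu>-1$, where $j_{\nu,n}$ stands for the $n$th positive zero of the Bessel function $J_{\nu}$.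
   Context: $J_\nu$ and $I_\nu$ are the Bessel and modified Bessel functions of the first kind of order $\nu$, $\Gamma$ is the Euler gamma function, and $\mathbb{N}=\{1,2,3,\dots\}$. Positive zeros are listed in increasing order. The left-hand side of the factorization is understood as an entire function of $z$: the power $z^{-2\nu-1}$ is taken with the branch cancelling the powers of $z$ in the Bessel functions, and the value at $z=0$ is the limit $1$. *)

theory Defs
  imports "HOL-Complex_Analysis.Complex_Analysis"
begin

text \<open>
  Bessel functions of the first kind of real order, with principal powers. Isabelle's convention
  \<open>0 powr 0 = 0\<close> would spoil the value of order \<open>0\<close> at the origin, hence the case distinction.
  The reciprocal Gamma function vanishes at the poles of Gamma, so no order is excluded.
\<close>

definition bessel_pow :: "real \<Rightarrow> complex \<Rightarrow> complex" where
  "bessel_pow \<nu> z = (if \<nu> = 0 then 1 else (z / 2) powr of_real \<nu>)"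

definition bessel_J :: "real \<Rightarrow> complex \<Rightarrow> complex" where
  "bessel_J \<nu> z = bessel_pow \<nu> z *
     (\<Sum>k. (- 1) ^ k * of_real (rGamma (\<nu> + real k + 1)) / fact k * (z / 2) ^ (2 * k))"

definition bessel_I :: "real \<Rightarrow> complex \<Rightarrow> complex" where
  "bessel_I \<nu> z = bessel_pow \<nu> z *
     (\<Sum>k. of_real (rGamma (\<nu> + real k + 1)) / fact k * (z / 2) ^ (2 * k))"

definition bessel_cross :: "real \<Rightarrow> complex \<Rightarrow> complex" where
  "bessel_cross \<nu> z =
     bessel_J (\<nu> + 1) z * bessel_I \<nu> z + bessel_J \<nu> z * bessel_I (\<nu> + 1) z"

text \<open>
  All powers are principal. As \<open>Ln (z / 2) = Ln z - ln 2\<close> for every \<open>z \<noteq> 0\<close>, the powers of \<open>z\<close>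
  cancel exactly, also on the branch cut. What is left is an entire function, whose value at the
  origin is supplied as a limit.
\<close>

definition bessel_cross_normalized :: "real \<Rightarrow> complex \<Rightarrow> complex" where
  "bessel_cross_normalized \<nu> z =
     (let g = (\<lambda>w. of_real (2 powr (2 * \<nu>)) * w powr of_real (- 2 * \<nu> - 1) *
                   of_real (Gamma (\<nu> + 1) * Gamma (\<nu> + 2)) * bessel_cross \<nu> w)
      in if z = 0 then Lim (at 0) g else g z)"

text \<open>
  The \<open>n\<close>-th positive zero in increasing order, for \<open>n \<ge> 1\<close>. Since infinite sets have cardinality
  \<open>0\<close>, the condition on the cardinality includes finiteness when \<open>n \<ge> 1\<close>.
\<close>

definition nth_pos_zero :: "(complex \<Rightarrow> complex) \<Rightarrow> nat \<Rightarrow> real" where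
  "nth_pos_zero f n =
     (THE x. 0 < x \<and> f (of_real x) = 0 \<and>
             card {y. 0 < y \<and> y \<le> x \<and> f (of_real y) = 0} = n)"

lemma nth_pos_zero_eqI:
  fixes x :: real
  assumes "n \<ge> 1" "0 < x" "f (of_real x) = 0"
    and card: "card {y. 0 < y \<and> y \<le> x \<and> f (of_real y) = 0} = n"
  shows "nth_pos_zero f n = x"
proof -
  define A where "A x = {y. 0 < y \<and> y \<le> x \<and> f (of_real y) = 0}" for x :: real
  have less: "card (A a) < card (A b)"
    if "card (A b) = n" "a < b" "0 < b" "f (of_real b) = 0" for a b
  proof (rule psubset_card_mono)
    show "finite (A b)"
      using that(1) assms(1) by (intro card_ge_0_finite) simp
    have "b \<in> A b" "b \<notin> A a"
      using that by (simp_all add: A_def)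
    moreover have "A a \<subseteq> A b"
      using that(2) by (auto simp: A_def)
    ultimately show "A a \<subset> A b"
      by blast
  qed
  show ?thesis
    unfolding nth_pos_zero_def A_def[symmetric]
  proof (rule the_equality)
    show "0 < x \<and> f (of_real x) = 0 \<and> card (A x) = n"
      using assms by (simp add: A_def)
  next
    fix w
    assume w: "0 < w \<and> f (of_real w) = 0 \<and> card (A w) = n"
    have "card (A x) = n"
      using card by (simp add: A_def)
    with w show "w = x"
      using less[of w x] less[of x w] assms(2,3) by (cases w x rule: linorder_cases) auto
  qed
qed

abbreviation bessel_zero :: "real \<Rightarrow> nat \<Rightarrow> real" where
  "bessel_zero \<nu> \<equiv> nth_pos_zero (bessel_J \<nu>)"

abbreviation cross_zero :: "real \<Rightarrow> nat \<Rightarrow> real" where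
  "cross_zero \<nu> \<equiv> nth_pos_zero (bessel_cross \<nu>)"

end

theory Submission
  imports Defs "HOL-Computational_Algebra.Fundamental_Theorem_Algebra" "HOL-Library.Diagonal_Subsequence"
begin

text \<open>
  Let \<open>w = (z / 2)\<^sup>2\<close>. Removing the power of \<open>z\<close> from the cross-product leaves an entire function \<open>G w\<close>,
  in which \<open>J\<close> and \<open>I\<close> are represented by the same entire series \<open>bessel_entire\<close> at \<open>- w\<close> and at \<open>w\<close>.
  Differential equations for the products of these series show that \<open>G\<close> is a constant multiple of
  the hypergeometric function 0F3 with the parameters \<open>\<nu> + 1\<close>, \<open>(\<nu> + 2) / 2\<close>, \<open>(\<nu> + 3) / 2\<close> at
  \<open>- w\<^sup>2 / 4 = - z ^ 4 / 64\<close> (\<open>cross_entire_eq_hyper_0F\<close>). The parameters are positive because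
  \<open>\<nu> > - 1\<close>.

  The factorization is an instance of a general one (\<open>hyper_0F_has_prod\<close>): for a nonempty list of
  positive parameters, the function 0Fq at \<open>- z\<close> is a product \<open>\<Prod>i. 1 - u i z\<close> with \<open>u i > 0\<close> and
  a summable \<open>u\<close>. Laguerre's operators \<open>p + z p' / a\<close> with \<open>a > 0\<close> preserve the class of polynomials
  all of whose roots are positive; repeated application turns \<open>(1 - z / c) ^ m\<close> into polynomials that
  converge to the given function. Their coefficients are bounded by \<open>K ^ n / (fact n)\<^sup>2\<close> uniformly in
  \<open>m\<close>; this bounds the \<open>k\<close>-th reciprocal root by a multiple of \<open>1 / (k + 1)\<^sup>2\<close>, again uniformly in \<open>m\<close>.
  Along a diagonal subsequence the reciprocal roots converge, and the summable majorant allows the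
  limit to be taken inside the product (\<open>product_compactness\<close>). In particular all zeros are positive,
  and there are infinitely many of them. The same theorem with the single parameter \<open>\<nu> + 1\<close> provides
  the zeros of the Bessel function.

  It remains to see that the zeros are simple and how they are ordered. On the positive axis, let \<open>A\<close>
  and \<open>B\<close> be the series of orders \<open>\<nu>\<close> and \<open>\<nu> + 1\<close> at \<open>- t\<close>, and \<open>C\<close>, \<open>D > 0\<close> those at \<open>t\<close>, so that
  \<open>G = B C + A D\<close>. At a zero of \<open>G\<close> the derivative is \<open>2 A C / t\<close>, and \<open>A\<close> and \<open>B\<close> have no common zero
  (\<open>bessel_no_common_zero\<close>), which gives simplicity. The derivatives also show that the plane curves
  \<open>(A, G)\<close> and \<open>(G, B)\<close> cross the coordinate axes only counterclockwise. Both start in the first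
  quadrant, so their coordinates vanish alternately (\<open>interlacing_zeros\<close>). These are the claimed
  inequalities, since the substitution \<open>t = (y / 2)\<^sup>2\<close> is increasing for positive \<open>y\<close>.
\<close>

section \<open>Polynomials with positive roots\<close>

text \<open>
  A condition on single complex zeros, whatever their multiplicity, so that it can be verified one
  zero at a time. The fundamental theorem of algebra turns it into a factorization over the reals.
\<close>

definition positive_rooted :: "complex poly \<Rightarrow> bool" where
  "positive_rooted p \<longleftrightarrow> (\<forall>z. poly p z = 0 \<longrightarrow> z \<in> of_real ` {0<..})"

text \<open>
  The list contains the reciprocals of the roots with multiplicity, so that the constant term is
  \<open>1\<close>. It is decreasing, hence the \<open>k\<close>-th entry can be bounded by the product of the first \<open>k\<close>
  factors and limits of such lists can be taken entry by entry.
\<close>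

lemma positive_rooted_factorization:
  assumes "positive_rooted p" and p0: "poly p 0 = 1"
  obtains us :: "real list"
    where "\<And>u. u \<in> set us \<Longrightarrow> 0 < u" "sorted_wrt (\<ge>) us"
      "\<And>z. poly p z = (\<Prod>u\<leftarrow>us. 1 - of_real u * z)"
proof -
  have "p \<noteq> 0" using p0 by auto
  from alg_closed_imp_factorization[OF this] obtain A where
    A: "p = smult (lead_coeff p) (\<Prod>x\<in>#A. [:-x, 1:])" by blast
  have poly_p: "poly p z = lead_coeff p * (\<Prod>x\<in>#A. z - x)" for z
  proof -
    have "poly (\<Prod>x\<in>#A. [:-x, 1:]) z = (\<Prod>x\<in>#A. z - x)"
      by (induction A) (auto simp: algebra_simps)
    thus ?thesis by (subst A) simp
  qed
  have root: "x \<in> of_real ` {0<..}" if "x \<in># A" for x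
  proof -
    have "0 \<in># image_mset (\<lambda>y. x - y) A"
      using that by (auto intro!: image_eqI[of _ _ x])
    hence "poly p x = 0"
      unfolding poly_p by (simp add: prod_mset_zero_iff)
    thus ?thesis using assms(1) by (auto simp: positive_rooted_def)
  qed
  have split: "(\<Prod>x\<in>#B. z - x) = (\<Prod>x\<in>#B. - x) * (\<Prod>x\<in>#B. 1 - of_real (1 / Re x) * z)"
    if "B \<subseteq># A" for B and z :: complex
    using that
  proof (induction B)
    case (add b B)
    hence "b \<in># A" by (auto dest: mset_subset_eqD)
    then obtain r where r: "b = of_real r" "r > 0"
      using root[of b] by auto
    have "z - b = - b * (1 - of_real (1 / Re b) * z)"
      using r by (simp add: field_simps)
    moreover have "B \<subseteq># A" using mset_subset_eq_insertD[OF add.prems] by (simp add: subset_mset.less_imp_le)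
    ultimately show ?case
      unfolding image_mset_add_mset prod_mset.add_mset using add.IH by (simp only: mult_ac)
  qed simp
  have "1 = lead_coeff p * (\<Prod>x\<in>#A. - x)"
    using poly_p[of 0] split[of A 0] p0 by simp
  hence prod: "poly p z = (\<Prod>x\<in>#A. 1 - of_real (1 / Re x) * z)" for z
    by (simp only: poly_p split[OF subset_mset.order_refl] mult.assoc [symmetric]) simp
  define us where "us = rev (sorted_list_of_multiset (image_mset (\<lambda>x. 1 / Re x) A))"
  have mset_us: "mset us = image_mset (\<lambda>x. 1 / Re x) A"
    by (simp add: us_def)
  show thesis
  proof (rule that[of us])
    fix u assume "u \<in> set us"
    hence "u \<in># image_mset (\<lambda>x. 1 / Re x) A"
      by (metis mset_us set_mset_mset)
    thus "0 < u" using root by fastforce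
  next
    show "sorted_wrt (\<ge>) us"
      unfolding us_def by (simp add: sorted_wrt_rev)
  next
    fix z
    have "(\<Prod>u\<leftarrow>us. 1 - of_real u * z) = (\<Prod>u\<in>#mset us. 1 - complex_of_real u * z)"
      by (simp flip: mset_map prod_mset_prod_list)
    also have "\<dots> = poly p z"
      by (simp add: mset_us prod multiset.map_comp o_def)
    finally show "poly p z = (\<Prod>u\<leftarrow>us. 1 - of_real u * z)" ..
  qed
qed

lemma Im_div_one_minus: "Im (w / (1 - w)) = Im w / (cmod (1 - w))\<^sup>2"
  by (simp add: Im_divide cmod_power2 flip: diff_divide_distrib) (simp add: algebra_simps)

text \<open>
  The logarithmic derivative of a product of linear factors, with the denominator cleared.
\<close>

lemma poly_pderiv_prod_list:
  assumes "\<And>u. u \<in> set us \<Longrightarrow> 1 - of_real u * z \<noteq> 0"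
  shows "z * poly (pderiv (\<Prod>u\<leftarrow>us. [:1, - of_real u:])) z =
    - (\<Sum>u\<leftarrow>us. of_real u * z / (1 - of_real u * z)) * (\<Prod>u\<leftarrow>us. 1 - of_real u * (z::complex))"
  using assms
proof (induction us)
  case (Cons u us)
  have p: "poly (\<Prod>u\<leftarrow>us. [:1, - of_real u:]) z = (\<Prod>u\<leftarrow>us. 1 - of_real u * z)"
    by (induction us) (auto simp: algebra_simps)
  let ?P = "\<Prod>u\<leftarrow>us. 1 - of_real u * z" and ?c = "1 - of_real u * z"
  have "?c \<noteq> 0" using Cons.prems by auto
  have "z * poly (pderiv (\<Prod>u\<leftarrow>u # us. [:1, - of_real u:])) z =
    ?c * (z * poly (pderiv (\<Prod>u\<leftarrow>us. [:1, - of_real u:])) z) - of_real u * z * ?P"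
    by (simp only: list.map prod_list.Cons pderiv_mult poly_add poly_mult p)
      (simp add: pderiv_pCons algebra_simps)
  also have "\<dots> = ?c * (- (\<Sum>u\<leftarrow>us. of_real u * z / (1 - of_real u * z)) * ?P)
      - of_real u * z / ?c * (?c * ?P)"
    using Cons \<open>?c \<noteq> 0\<close> by (simp add: mult.assoc)
  also have "\<dots> = - (\<Sum>u\<leftarrow>u # us. of_real u * z / (1 - of_real u * z)) * (?c * ?P)"
    by (simp only: list.map sum_list.Cons ring_distribs) (simp add: algebra_simps)
  finally show ?case by simp
qed simp

text \<open>
  Laguerre's operator \<open>p + z p' / a\<close> multiplies the \<open>n\<close>-th coefficient by \<open>(a + n) / a\<close>. A zero \<open>z\<close> of
  the result that is not a zero of \<open>p = (\<Prod>u. 1 - u z)\<close> satisfies \<open>(\<Sum>u. u z / (1 - u z)) = a\<close>. The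
  imaginary part of every term has the sign of \<open>Im z\<close>, so \<open>z\<close> is real; every term is nonpositive
  for \<open>z \<le> 0\<close>, so \<open>z\<close> is positive.
\<close>

lemma positive_rooted_Laguerre:
  fixes a :: real
  assumes "positive_rooted p" and p0: "poly p 0 = 1" and "a > 0"
  shows "positive_rooted (p + smult (of_real (1 / a)) (pCons 0 (pderiv p)))"
  unfolding positive_rooted_def
proof (intro allI impI)
  fix z assume z: "poly (p + smult (of_real (1 / a)) (pCons 0 (pderiv p))) z = 0"
  show "z \<in> of_real ` {0<..}"
  proof (cases "poly p z = 0")
    case True
    thus ?thesis using assms(1) by (auto simp: positive_rooted_def)
  next
    case nz: False
    obtain us where us: "\<And>u. u \<in> set us \<Longrightarrow> 0 < u" 
      "\<And>z. poly p z = (\<Prod>u\<leftarrow>us. 1 - of_real u * z)"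
      using positive_rooted_factorization[OF assms(1,2)] by metis
    have "poly p w = poly (\<Prod>u\<leftarrow>us. [:1, - of_real u:]) w" for w
      unfolding us(2) by (induction us) (auto simp: algebra_simps)
    hence p_eq: "p = (\<Prod>u\<leftarrow>us. [:1, - of_real u:])"
      by (simp flip: poly_eq_poly_eq_iff add: fun_eq_iff)
    have ne: "1 - of_real u * z \<noteq> 0" if "u \<in> set us" for u
      using nz that unfolding us(2) by (auto simp: prod_list_zero_iff)
    let ?S = "\<Sum>u\<leftarrow>us. of_real u * z / (1 - of_real u * z)"
    have "z * poly (pderiv p) z = - ?S * poly p z"
      using poly_pderiv_prod_list[OF ne] us(2) p_eq by simp
    hence "poly p z * (1 - of_real (1 / a) * ?S) = 0"
      using z by (simp add: algebra_simps)
    hence S: "?S = of_real a"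
      using nz \<open>a > 0\<close> by (simp add: field_simps)
    have ImS: "Im ?S = (\<Sum>u\<leftarrow>us. u / (cmod (1 - of_real u * z))\<^sup>2) * Im z"
      by (induction us) (simp_all add: Im_div_one_minus ring_distribs)
    have "us \<noteq> []" using S \<open>a > 0\<close> by auto
    moreover have "0 < u / (cmod (1 - of_real u * z))\<^sup>2" if "u \<in> set us" for u
      using us(1)[OF that] ne[OF that] by simp
    ultimately have "0 < (\<Sum>u\<leftarrow>us. u / (cmod (1 - of_real u * z))\<^sup>2)"
    proof (induction us)
      case (Cons u us)
      thus ?case by (cases us) (auto intro!: add_pos_pos)
    qed auto
    hence "Im z = 0" using S ImS by auto
    then obtain x where x: "z = of_real x" using complex_is_Real_iff by (auto elim: Reals_cases)
    have "x > 0"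
    proof (rule ccontr)
      assume "\<not> x > 0"
      have "(\<Sum>u\<leftarrow>us. u * x / (1 - u * x)) \<le> 0"
      proof (intro sum_list_nonpos)
        fix t assume "t \<in> set (map (\<lambda>u. u * x / (1 - u * x)) us)"
        then obtain u where u: "u \<in> set us" "t = u * x / (1 - u * x)" by auto
        have "u * x \<le> 0"
          using us(1)[OF u(1)] \<open>\<not> x > 0\<close> by (simp add: mult_le_0_iff)
        thus "t \<le> 0" unfolding u(2) by (intro divide_nonpos_pos) auto
      qed
      moreover have "?S = of_real (\<Sum>u\<leftarrow>us. u * x / (1 - u * x))"
        unfolding x by (induction us) auto
      ultimately show False using S \<open>a > 0\<close> by (metis of_real_eq_iff not_le)
    qed
    thus ?thesis using x by auto
  qed
qed

text \<open>
  Applying Laguerre's operator with \<open>a\<close>, \<open>a + 1\<close>, ..., \<open>a + m - 1\<close> multiplies the \<open>n\<close>-th coefficient by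
  \<open>pochhammer a (n + m) / (pochhammer a n * pochhammer a m)\<close>. Divided by \<open>m ^ n\<close>, this tends to
  \<open>1 / pochhammer a n\<close>, which is how the denominators of a hypergeometric series are reached from
  polynomials.
\<close>

lemma positive_rooted_multiplier:
  fixes a :: real
  assumes "positive_rooted p" "coeff p 0 = 1" "a > 0"
  obtains q where "positive_rooted q"
    "\<And>n. coeff q n = of_real (pochhammer (a + n) m / pochhammer a m) * coeff p n"
proof -
  have "\<exists>q. positive_rooted q \<and>
    (\<forall>n. coeff q n = of_real (pochhammer (a + n) m / pochhammer a m) * coeff p n)"
  proof (induction m)
    case 0
    thus ?case using assms by auto
  next
    case (Suc m)
    then obtain q where q: "positive_rooted q"
      "\<And>n. coeff q n = of_real (pochhammer (a + n) m / pochhammer a m) * coeff p n" by blast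
    have pos: "pochhammer a m > 0" using assms by (intro pochhammer_pos) auto
    let ?r = "q + smult (of_real (1 / (a + m))) (pCons 0 (pderiv q))"
    have "positive_rooted ?r"
      using q pos assms by (intro positive_rooted_Laguerre) (auto simp: poly_0_coeff_0)
    moreover have "coeff ?r n = of_real (pochhammer (a + n) (Suc m) / pochhammer a (Suc m)) * coeff p n" for n
    proof -
      have "coeff ?r n = of_real (1 + n / (a + m)) * coeff q n"
        by (cases n) (simp_all add: coeff_pderiv ring_distribs add_divide_distrib)
      also have "1 + n / (a + m) = (a + n + m) / (a + m)"
        using assms by (simp add: field_simps)
      finally show ?thesis by (simp add: q(2) pochhammer_Suc mult_ac)
    qed
    ultimately show ?case by blast
  qed
  thus ?thesis using that by blast
qed

lemma positive_rooted_multipliers: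
  fixes as :: "real list"
  assumes "positive_rooted p" "coeff p 0 = 1" "\<And>a. a \<in> set as \<Longrightarrow> a > 0"
  shows "\<exists>q. positive_rooted q \<and>
    (\<forall>n. coeff q n = of_real (\<Prod>a\<leftarrow>as. pochhammer (a + n) m / pochhammer a m) * coeff p n)"
  using assms(3)
proof (induction as)
  case Nil
  thus ?case using assms by auto
next
  case (Cons a as)
  then obtain q where q: "positive_rooted q"
    "\<And>n. coeff q n = of_real (\<Prod>a\<leftarrow>as. pochhammer (a + n) m / pochhammer a m) * coeff p n"
    by auto
  have "pochhammer a m \<noteq> 0" if "a \<in> set as" for a
    using Cons.prems[of a] that pochhammer_pos[of a m] by auto
  hence "(\<Prod>a\<leftarrow>as. pochhammer a m / pochhammer a m) = 1"
    by (induction as) auto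
  hence "coeff q 0 = 1"
    using q(2)[of 0] assms(2) by simp
  then obtain r where "positive_rooted r"
    "\<And>n. coeff r n = of_real (pochhammer (a + n) m / pochhammer a m) * coeff q n"
    using positive_rooted_multiplier[OF q(1), of a m] Cons.prems by auto
  thus ?case using q(2) by (intro exI[of _ r]) auto
qed

section \<open>Polynomial approximations of hypergeometric functions\<close>

definition hyper_coeff :: "real list \<Rightarrow> nat \<Rightarrow> real" where
  "hyper_coeff as n = 1 / (fact n * (\<Prod>a\<leftarrow>as. pochhammer a n))"

text \<open>
  The generalized hypergeometric function without numerator parameters and with the denominator
  parameters \<open>as\<close>.
\<close>

definition hyper_0F :: "real list \<Rightarrow> complex \<Rightarrow> complex" where
  "hyper_0F as z = (\<Sum>n. of_real (hyper_coeff as n) * z ^ n)"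

text \<open>
  Up to the sign \<open>(-1) ^ n\<close>, the coefficients of the polynomial that the multipliers with the
  parameters \<open>as\<close> produce from \<open>(1 - z / m ^ (length as + 1)) ^ m\<close>.
\<close>

definition approx_coeff :: "real list \<Rightarrow> nat \<Rightarrow> nat \<Rightarrow> real" where
  "approx_coeff as m n =
     real (m choose n) / real m ^ n * (\<Prod>a\<leftarrow>as. pochhammer (a + n) m / pochhammer a m / real m ^ n)"

text \<open>
  Read from left to right: \<open>m\<close> multipliers acting on the \<open>n\<close>-th coefficient amount to a quotient with
  \<open>n\<close> factors. This form has a visible limit as \<open>m\<close> tends to infinity.
\<close>

lemma pochhammer_shift_ratio:
  fixes a :: real
  assumes "a > 0"
  shows "pochhammer (a + n) m / pochhammer a m = pochhammer (a + m) n / pochhammer a n"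
proof -
  have "pochhammer a n * pochhammer (a + n) m = pochhammer a m * pochhammer (a + m) n"
    by (metis add.commute pochhammer_product')
  thus ?thesis
    using pochhammer_pos[OF assms, of n] pochhammer_pos[OF assms, of m] by (simp add: field_simps)
qed

lemma approx_coeff_altdef:
  assumes "\<And>a. a \<in> set as \<Longrightarrow> a > 0"
  shows "approx_coeff as m n =
     real (m choose n) / real m ^ n * (\<Prod>a\<leftarrow>as. (pochhammer (a + m) n / real m ^ n) / pochhammer a n)"
proof -
  have "map (\<lambda>a. pochhammer (a + n) m / pochhammer a m / real m ^ n) as =
    map (\<lambda>a. (pochhammer (a + m) n / real m ^ n) / pochhammer a n) as"
    using assms by (intro map_cong) (auto simp: pochhammer_shift_ratio)
  thus ?thesis by (simp only: approx_coeff_def)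
qed

lemma tendsto_linear_over_self: "(\<lambda>m. (c + real m) / real m) \<longlonglongrightarrow> 1"
proof -
  have "(\<lambda>m. c / real m + 1) \<longlonglongrightarrow> 0 + 1"
    by (intro tendsto_intros lim_const_over_n)
  moreover have "eventually (\<lambda>m. c / real m + 1 = (c + real m) / real m) sequentially"
    using eventually_gt_at_top[of 0] by eventually_elim (simp add: field_simps)
  ultimately show ?thesis by (simp add: Lim_transform_eventually)
qed

lemma tendsto_pochhammer_over_power: "(\<lambda>m. pochhammer (a + real m) n / real m ^ n) \<longlonglongrightarrow> 1"
proof (induction n)
  case (Suc n)
  have "(\<lambda>m. (pochhammer (a + real m) n / real m ^ n) * ((a + n + real m) / real m)) \<longlonglongrightarrow> 1 * 1"
    by (intro tendsto_mult Suc tendsto_linear_over_self)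
  thus ?case by (simp add: pochhammer_Suc algebra_simps)
qed simp

lemma tendsto_binomial_over_power: "(\<lambda>m. real (m choose n) / real m ^ n) \<longlonglongrightarrow> 1 / fact n"
proof -
  have "(\<lambda>m. (\<Prod>i = 0..<n. (- real i + real m) / real m) / fact n) \<longlonglongrightarrow> (\<Prod>i = 0..<n. 1) / fact n"
    by (intro tendsto_intros tendsto_linear_over_self) auto
  moreover have "(\<Prod>i = 0..<n. (- real i + real m) / real m) / fact n = real (m choose n) / real m ^ n" for m
    by (simp add: binomial_gbinomial gbinomial_prod_rev prod_dividef)
  ultimately show ?thesis by simp
qed

lemma tendsto_approx_coeff:
  assumes "\<And>a. a \<in> set as \<Longrightarrow> a > 0"
  shows "(\<lambda>m. approx_coeff as m n) \<longlonglongrightarrow> hyper_coeff as n"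
proof -
  have "(\<lambda>m. \<Prod>a\<leftarrow>as. (pochhammer (a + real m) n / real m ^ n) / pochhammer a n) \<longlonglongrightarrow>
      (\<Prod>a\<leftarrow>as. 1 / pochhammer a n)"
    using assms
  proof (induction as)
    case (Cons a as)
    have "pochhammer a n \<noteq> 0" using pochhammer_pos[of a n] Cons.prems[of a] by auto
    thus ?case
      using Cons unfolding list.map prod_list.Cons
      by (intro tendsto_mult tendsto_divide tendsto_pochhammer_over_power tendsto_const) auto
  qed simp
  from tendsto_mult[OF tendsto_binomial_over_power this]
  have "(\<lambda>m. approx_coeff as m n) \<longlonglongrightarrow> 1 / fact n * (\<Prod>a\<leftarrow>as. 1 / pochhammer a n)"
    using assms by (simp add: approx_coeff_altdef)
  also have "(\<Prod>a\<leftarrow>as. 1 / pochhammer a n) = 1 / (\<Prod>a\<leftarrow>as. pochhammer a n)"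
    by (induction as) auto
  finally show ?thesis by (simp add: hyper_coeff_def)
qed

lemma pochhammer_ge:
  fixes a :: real
  assumes "a > 0"
  shows "min a 1 ^ n * fact n \<le> pochhammer a n"
proof (induction n)
  case (Suc n)
  have "min a 1 * (1 + real n) \<le> a + real n"
    using assms by (cases "a \<le> 1") (auto simp: algebra_simps min_def mult_left_le_one_le)
  hence "(min a 1 ^ n * fact n) * (min a 1 * (1 + real n)) \<le> pochhammer a n * (a + real n)"
    using assms by (intro mult_mono Suc pochhammer_nonneg) auto
  thus ?case by (simp add: pochhammer_Suc algebra_simps)
qed simp

text \<open>
  Every factor \<open>(a + m + i) / m\<close> with \<open>i < n \<le> m\<close> is at most \<open>a + 2\<close>. For larger \<open>n\<close> the binomial
  coefficient in \<open>approx_coeff\<close> vanishes.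
\<close>

lemma multiplier_bound:
  fixes a :: real
  assumes "a > 0" "n \<le> m" "m \<ge> 1"
  shows "0 \<le> pochhammer (a + m) n / real m ^ n / pochhammer a n"
    "pochhammer (a + m) n / real m ^ n / pochhammer a n \<le> ((a + 2) / min a 1) ^ n / fact n"
proof -
  have pos: "pochhammer a n > 0" "pochhammer (a + m) n > 0"
    using assms by (auto intro!: pochhammer_pos)
  thus "0 \<le> pochhammer (a + m) n / real m ^ n / pochhammer a n" by simp
  have "pochhammer (a + m) k / real m ^ k \<le> (a + 2) ^ k" if "k \<le> n" for k
    using that
  proof (induction k)
    case (Suc k)
    have "a \<le> a * real m" "real k \<le> real m" using Suc.prems assms by auto
    hence "a + m + k \<le> (a + 2) * real m"
      unfolding ring_distribs by linarith
    hence "(a + m + k) / m \<le> a + 2"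
      using assms by (simp add: divide_le_eq)
    hence "(pochhammer (a + m) k / real m ^ k) * ((a + m + k) / m) \<le> (a + 2) ^ k * (a + 2)"
      using Suc assms by (intro mult_mono) auto
    thus ?case by (simp add: pochhammer_Suc algebra_simps)
  qed simp
  hence "pochhammer (a + m) n / real m ^ n / pochhammer a n \<le> (a + 2) ^ n / (min a 1 ^ n * fact n)"
    using assms pos pochhammer_ge[OF assms(1), of n] by (intro frac_le) auto
  thus "pochhammer (a + m) n / real m ^ n / pochhammer a n \<le> ((a + 2) / min a 1) ^ n / fact n"
    by (simp add: power_divide)
qed

lemma multiplier_list_bound:
  assumes "\<And>a. a \<in> set as \<Longrightarrow> a > 0" "n \<le> m" "m \<ge> 1"
  defines "f \<equiv> \<lambda>a. pochhammer (a + m) n / real m ^ n / pochhammer a n"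
    and "K \<equiv> (\<Prod>a\<leftarrow>as. (a + 2) / min a 1)"
  shows "0 \<le> (\<Prod>a\<leftarrow>as. f a) \<and> (\<Prod>a\<leftarrow>as. f a) \<le> K ^ n / fact n ^ length as"
  using assms(1) unfolding K_def
proof (induction as)
  case (Cons a as)
  have "0 \<le> f a" "f a \<le> ((a + 2) / min a 1) ^ n / fact n"
    using multiplier_bound[of a n m] Cons.prems assms(2,3) by (auto simp: f_def)
  moreover have "0 \<le> (\<Prod>a\<leftarrow>as. f a)" 
    "(\<Prod>a\<leftarrow>as. f a) \<le> (\<Prod>a\<leftarrow>as. (a + 2) / min a 1) ^ n / fact n ^ length as"
    using Cons by auto
  ultimately have "f a * (\<Prod>a\<leftarrow>as. f a) \<le>
    (((a + 2) / min a 1) ^ n / fact n) * ((\<Prod>a\<leftarrow>as. (a + 2) / min a 1) ^ n / fact n ^ length as)"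
    by (intro mult_mono) auto
  thus ?case using \<open>0 \<le> f a\<close> \<open>0 \<le> (\<Prod>a\<leftarrow>as. f a)\<close> by (simp add: power_mult_distrib power_divide)
qed simp

text \<open>
  The bound is uniform in \<open>m\<close>. One factorial in the denominator comes from the binomial coefficient
  and one from each parameter, so a single parameter suffices for the square of the factorial. This
  square expresses growth of order at most \<open>1 / 2\<close>, and it is what excludes an exponential factor in
  the limit.
\<close>

lemma approx_coeff_bound:
  assumes "\<And>a. a \<in> set as \<Longrightarrow> a > 0" "as \<noteq> []"
  obtains K where "K > 0"
    "\<And>m n. m \<ge> 1 \<Longrightarrow> 0 \<le> approx_coeff as m n"
    "\<And>m n. m \<ge> 1 \<Longrightarrow> approx_coeff as m n \<le> K ^ n / (fact n)\<^sup>2"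
proof -
  define K where "K = (\<Prod>a\<leftarrow>as. (a + 2) / min a 1)"
  have "K > 0"
    unfolding K_def using assms(1)
  proof (induction as)
    case (Cons a as)
    have "0 < a" "0 < (\<Prod>a\<leftarrow>as. (a + 2) / min a 1)" using Cons by auto
    thus ?case by simp
  qed simp
  have "0 \<le> approx_coeff as m n \<and> approx_coeff as m n \<le> K ^ n / (fact n)\<^sup>2" if "m \<ge> 1" for m n
  proof (cases "n \<le> m")
    case False
    thus ?thesis using \<open>K > 0\<close> by (simp add: approx_coeff_def binomial_eq_0)
  next
    case True
    let ?P = "\<Prod>a\<leftarrow>as. pochhammer (a + m) n / real m ^ n / pochhammer a n"
    have P: "0 \<le> ?P" "?P \<le> K ^ n / fact n ^ length as"
      using multiplier_list_bound[of as n m] assms(1) True that by (auto simp: K_def)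
    note P(2)
    also have "K ^ n / fact n ^ length as \<le> K ^ n / fact n ^ 1"
      using assms(2) \<open>K > 0\<close>
      by (intro divide_left_mono power_increasing mult_pos_pos zero_less_power)
         (auto simp: Suc_le_eq fact_ge_1)
    finally have P': "?P \<le> K ^ n / fact n" by simp
    have "real (m choose n) * fact n \<le> real m ^ n"
      using binomial_fact_pow[of m n] by (metis of_nat_fact of_nat_le_iff of_nat_mult of_nat_power)
    hence "real (m choose n) / real m ^ n \<le> 1 / fact n"
      using that by (simp add: field_simps)
    hence "real (m choose n) / real m ^ n * ?P \<le> 1 / fact n * (K ^ n / fact n)"
      using P P' by (intro mult_mono) auto
    thus ?thesis using P assms(1) by (simp add: approx_coeff_altdef power2_eq_square)
  qed
  thus ?thesis using \<open>K > 0\<close> that by blast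
qed

text \<open>
  The sum is at most the square of a partial sum of the exponential series at \<open>sqrt y\<close>.
\<close>

lemma sum_inverse_fact_square_le:
  assumes "y \<ge> (0::real)"
  shows "(\<Sum>n<N. y ^ n / (fact n)\<^sup>2) \<le> exp (2 * sqrt y)"
proof -
  let ?t = "\<lambda>n. sqrt y ^ n / fact n"
  have "(\<Sum>n<N. y ^ n / (fact n)\<^sup>2) = (\<Sum>n<N. ?t n * ?t n)"
    using assms by (intro sum.cong) (auto simp: power2_eq_square simp flip: power_mult_distrib)
  also have "\<dots> \<le> (\<Sum>n<N. ?t n * (\<Sum>k<N. ?t k))"
    using assms by (intro sum_mono mult_left_mono member_le_sum) auto
  also have "\<dots> = (\<Sum>n<N. ?t n) * (\<Sum>n<N. ?t n)"
    by (simp add: sum_distrib_right)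
  also have "(\<Sum>n<N. ?t n) \<le> exp (sqrt y)"
  proof -
    have "?t sums exp (sqrt y)"
      using exp_converges[of "sqrt y"] by (simp add: divide_inverse mult.commute)
    moreover have "(\<Sum>n<N. ?t n) \<le> suminf ?t"
      using assms calculation by (intro sum_le_suminf) (auto simp: sums_iff)
    ultimately show ?thesis by (simp add: sums_iff)
  qed
  hence "(\<Sum>n<N. ?t n) * (\<Sum>n<N. ?t n) \<le> exp (sqrt y) * exp (sqrt y)"
    using assms by (intro mult_mono) (auto intro: sum_nonneg)
  finally show ?thesis by (simp flip: exp_add)
qed

text \<open>
  On the negative axis the polynomial \<open>q = (\<Prod>i. 1 - u i z)\<close> is at least \<open>(1 + x u k) ^ (k + 1)\<close> at \<open>- x\<close>,
  since the \<open>u i\<close> decrease, while the bound on its coefficients gives \<open>q (- x) \<le> exp (2 sqrt (K x))\<close>.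
  The choice \<open>x = (k + 1)\<^sup>2\<close> balances both and bounds \<open>u k\<close> by a multiple of \<open>1 / (k + 1)\<^sup>2\<close> with a
  factor that does not depend on \<open>m\<close>. Padding with zeros makes \<open>u\<close> an infinite sequence.
\<close>

lemma approximant_factorization:
  assumes "\<And>a. a \<in> set as \<Longrightarrow> a > 0" "m \<ge> 1"
    and K: "K > 0" "\<And>n. 0 \<le> approx_coeff as m n" "\<And>n. approx_coeff as m n \<le> K ^ n / (fact n)\<^sup>2"
  shows "\<exists>u :: nat \<Rightarrow> real.
    (\<forall>i. 0 \<le> u i \<and> u i \<le> exp (2 * sqrt K) / (real i + 1)\<^sup>2) \<and> decseq u \<and>
    (\<forall>z :: complex. (\<lambda>n. \<Prod>i<n. 1 - of_real (u i) * z) \<longlonglongrightarrow>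
        (\<Sum>n. of_real (approx_coeff as m n) * (- z) ^ n))"
proof -
  \<comment> \<open>One power of \<open>m\<close> for the binomial coefficient and one for each parameter.\<close>
  define c where "c = 1 / real m ^ (length as + 1)"
  have c: "c > 0" using assms(2) by (simp add: c_def)
  define p where "p = [:1, - complex_of_real c:] ^ m"
  have "positive_rooted p"
    unfolding positive_rooted_def p_def
  proof (intro allI impI)
    fix z :: complex assume "poly ([:1, - of_real c:] ^ m) z = 0"
    hence "z = of_real (1 / c)" using c by (auto simp: field_simps)
    thus "z \<in> of_real ` {0<..}" using c by (intro image_eqI[of _ _ "1 / c"]) auto
  qed
  moreover have coeff_p: "coeff p n = of_nat (m choose n) * (- of_real c) ^ n" for n
  proof (cases "n \<le> m")
    case False
    have "degree p \<le> 1 * m"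
      unfolding p_def by (rule order.trans[OF degree_power_le]) auto
    thus ?thesis using False by (simp add: coeff_eq_0 binomial_eq_0)
  qed (simp add: p_def coeff_linear_poly_power)
  ultimately obtain q where q: "positive_rooted q"
    "\<And>n. coeff q n = of_real (\<Prod>a\<leftarrow>as. pochhammer (a + n) m / pochhammer a m) * coeff p n"
    using positive_rooted_multipliers[of p as m] assms(1) by auto
  have coeff_q: "coeff q n = of_real (approx_coeff as m n) * (- 1) ^ n" for n
  proof -
    have "(\<Prod>a\<leftarrow>as. pochhammer (a + n) m / pochhammer a m / real m ^ n) =
      (\<Prod>a\<leftarrow>as. pochhammer (a + n) m / pochhammer a m) / real m ^ (n * length as)"
      by (induction as) (simp_all add: power_add)
    hence "approx_coeff as m n = (\<Prod>a\<leftarrow>as. pochhammer (a + n) m / pochhammer a m) * (m choose n) * c ^ n"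
      by (simp add: approx_coeff_def c_def power_add power_divide power_mult_distrib mult.commute flip: power_mult)
    moreover have "(- complex_of_real c) ^ n = of_real (c ^ n) * (- 1) ^ n"
      by (subst power_minus) simp
    ultimately show ?thesis by (simp add: q(2) coeff_p)
  qed
  have "approx_coeff as m 0 = 1"
  proof -
    have "pochhammer a m \<noteq> 0" if "a \<in> set as" for a
      using assms(1)[of a] that pochhammer_pos[of a m] by auto
    hence "(\<Prod>a\<leftarrow>as. pochhammer a m / pochhammer a m) = 1"
      by (induction as) auto
    thus ?thesis by (simp add: approx_coeff_def)
  qed
  hence "poly q 0 = 1" by (simp add: poly_0_coeff_0 coeff_q)
  then obtain us where us: "\<And>u. u \<in> set us \<Longrightarrow> 0 < u" "sorted_wrt (\<ge>) us"
    "\<And>z. poly q z = (\<Prod>u\<leftarrow>us. 1 - of_real u * z)"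
    using positive_rooted_factorization[OF q(1)] by metis
  define u where "u i = (if i < length us then us ! i else 0)" for i
  have u_nonneg: "0 \<le> u i" for i
    using us(1) by (auto simp: u_def less_imp_le)
  have dec: "decseq u"
    unfolding decseq_def
  proof (intro allI impI)
    fix i j :: nat assume "i \<le> j"
    thus "u j \<le> u i"
      using sorted_wrt_nth_less[OF us(2), of i j] us(1)[of "us ! i"]
      by (cases "i = j") (auto simp: u_def dest: less_imp_le)
  qed
  have prod_u: "(\<Prod>i<n. 1 - of_real (u i) * z) = poly q z" if "n \<ge> length us" for n z
  proof -
    have "(\<Prod>i<n. 1 - of_real (u i) * z) = (\<Prod>i<length us. 1 - of_real (u i) * z)"
      using that by (intro prod.mono_neutral_right) (auto simp: u_def)
    also have "\<dots> = (\<Prod>i<length us. 1 - of_real (us ! i) * z)"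
      by (intro prod.cong) (auto simp: u_def)
    also have "\<dots> = poly q z"
      by (simp add: us(3) prod.list_conv_set_nth atLeast0LessThan)
    finally show ?thesis .
  qed
  have poly_q: "poly q z = (\<Sum>n<Suc (degree q). of_real (approx_coeff as m n) * (- z) ^ n)" for z
    by (simp add: poly_altdef coeff_q lessThan_Suc_atMost mult.assoc flip: power_mult_distrib)
  have "approx_coeff as m n = 0" if "n > degree q" for n
    using coeff_eq_0[OF that] by (simp add: coeff_q)
  hence poly_q': "poly q z = (\<Sum>n. of_real (approx_coeff as m n) * (- z) ^ n)" for z
    unfolding poly_q by (intro suminf_finite [symmetric]) auto
  have bound: "u k \<le> exp (2 * sqrt K) / (real k + 1)\<^sup>2" for k
  proof -
    define x where "x = (real k + 1)\<^sup>2"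
    have x: "x > 0" by (simp add: x_def)
    define n where "n = max (Suc k) (length us)"
    have "(1 + x * u k) ^ Suc k = (\<Prod>i<Suc k. 1 + x * u k)" by simp
    also have "\<dots> \<le> (\<Prod>i<Suc k. 1 + x * u i)"
      using dec x u_nonneg by (intro prod_mono) (auto simp: decseq_def)
    also have "\<dots> \<le> (\<Prod>i<n. 1 + x * u i)"
      using x u_nonneg by (intro prod_mono2) (auto simp: n_def)
    also have "complex_of_real \<dots> = poly q (- of_real x)"
      using prod_u[of n "- of_real x"] by (simp add: n_def mult.commute)
    hence "(\<Prod>i<n. 1 + x * u i) = (\<Sum>n<Suc (degree q). approx_coeff as m n * x ^ n)"
      unfolding poly_q minus_minus of_real_power [symmetric] of_real_mult [symmetric] of_real_sum [symmetric]
        of_real_eq_iff .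
    also have "\<dots> \<le> (\<Sum>n<Suc (degree q). (K * x) ^ n / (fact n)\<^sup>2)"
      using K x by (intro sum_mono) (simp add: power_mult_distrib mult_right_mono flip: times_divide_eq_left)
    also have "\<dots> \<le> exp (2 * sqrt (K * x))"
      using K x by (intro sum_inverse_fact_square_le) auto
    also have "\<dots> = exp (2 * sqrt K) ^ Suc k"
      unfolding exp_of_nat_mult [symmetric] by (simp add: x_def real_sqrt_mult algebra_simps)
    finally have "1 + x * u k \<le> exp (2 * sqrt K)"
      by (rule power_le_imp_le_base) simp
    thus ?thesis using x by (simp add: x_def field_simps)
  qed
  have "(\<lambda>n. \<Prod>i<n. 1 - of_real (u i) * z) \<longlonglongrightarrow>
      (\<Sum>n. of_real (approx_coeff as m n) * (- z) ^ n)" for z :: complex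
  proof -
    have "eventually (\<lambda>n. (\<Prod>i<n. 1 - of_real (u i) * z) = poly q z) sequentially"
      using eventually_ge_at_top[of "length us"] by eventually_elim (rule prod_u)
    thus ?thesis by (simp add: tendsto_eventually poly_q')
  qed
  thus ?thesis using u_nonneg bound dec by (intro exI[of _ u]) simp
qed

lemma power_over_fact_square_summable:
  assumes "x \<ge> (0::real)"
  shows "summable (\<lambda>n. x ^ n / (fact n)\<^sup>2)"
proof (rule summable_comparison_test')
  show "summable (\<lambda>n. x ^ n / fact n)"
    using summable_exp[of x] by (simp add: divide_inverse mult.commute)
  fix n
  show "norm (x ^ n / (fact n)\<^sup>2) \<le> x ^ n / fact n"
    using assms by (auto intro!: divide_left_mono simp: self_le_power fact_ge_1)
qed

lemma approximants_converge:
  assumes "\<And>a. a \<in> set as \<Longrightarrow> a > 0"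
    and K: "\<And>m n. m \<ge> 1 \<Longrightarrow> 0 \<le> approx_coeff as m n"
      "\<And>m n. m \<ge> 1 \<Longrightarrow> approx_coeff as m n \<le> K ^ n / (fact n)\<^sup>2" "K > 0"
  shows "summable (\<lambda>n. norm (of_real (hyper_coeff as n) * z ^ n :: complex))"
    and "(\<lambda>m. \<Sum>n. of_real (approx_coeff as m n) * z ^ n) \<longlonglongrightarrow> hyper_0F as z"
proof -
  have "eventually (\<lambda>(n, m). norm (of_real (approx_coeff as m n) * z ^ n) \<le> (K * norm z) ^ n / (fact n)\<^sup>2)
      (at_top \<times>\<^sub>F sequentially)"
  proof -
    have "norm (of_real (approx_coeff as m n) * z ^ n) \<le> (K * norm z) ^ n / (fact n)\<^sup>2" if "m \<ge> 1" for m n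
    proof -
      have "norm (of_real (approx_coeff as m n) * z ^ n) = approx_coeff as m n * norm z ^ n"
        using K(1)[OF that] by (simp add: norm_mult norm_power)
      also have "\<dots> \<le> K ^ n / (fact n)\<^sup>2 * norm z ^ n"
        using K(2)[OF that] by (intro mult_right_mono) auto
      finally show ?thesis by (simp add: power_mult_distrib)
    qed
    thus ?thesis
      by (intro eventually_prod_filter[THEN iffD2] exI[of _ "\<lambda>_. True"] exI[of _ "\<lambda>m. m \<ge> 1"])
         (auto simp: eventually_ge_at_top)
  qed
  note tannery = tannerys_theorem[OF _ this, of "\<lambda>n. of_real (hyper_coeff as n) * z ^ n"]
  have "summable (\<lambda>n. (K * cmod z) ^ n / (fact n)\<^sup>2)"
    using \<open>K > 0\<close> by (intro power_over_fact_square_summable) auto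
  note tannery = tannery[OF _ this]
  have "summable (\<lambda>n. norm (of_real (hyper_coeff as n) * z ^ n :: complex)) \<and>
    (\<lambda>m. \<Sum>n. of_real (approx_coeff as m n) * z ^ n) \<longlonglongrightarrow> hyper_0F as z"
    unfolding hyper_0F_def
    by (rule conjunct2[OF tannery]) (auto intro!: tendsto_intros tendsto_approx_coeff assms(1))
  thus "summable (\<lambda>n. norm (of_real (hyper_coeff as n) * z ^ n :: complex))"
    and "(\<lambda>m. \<Sum>n. of_real (approx_coeff as m n) * z ^ n) \<longlonglongrightarrow> hyper_0F as z"
    by blast+
qed

section \<open>Products without exponential factors for hypergeometric functions\<close>

lemma diagonal_subsequence:
  fixes U :: "nat \<Rightarrow> nat \<Rightarrow> real"
  assumes "\<And>m i. 0 \<le> U m i" "\<And>m i. U m i \<le> B i"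
  shows "\<exists>d u. strict_mono (d :: nat \<Rightarrow> nat) \<and> (\<forall>i. (\<lambda>m. U (d m) i) \<longlonglongrightarrow> u i)"
proof -
  interpret subseqs "\<lambda>i s. convergent (\<lambda>m. U (s m) i)"
  proof
    fix i and s :: "nat \<Rightarrow> nat"
    have "bounded (range (\<lambda>m. U (s m) i))"
      using assms by (intro boundedI[of _ "B i"]) (auto simp: abs_of_nonneg)
    from bounded_imp_convergent_subsequence[OF this]
    show "\<exists>r. strict_mono r \<and> convergent (\<lambda>m. U ((s \<circ> r) m) i)"
      by (auto simp: convergent_def o_def)
  qed
  have "convergent (\<lambda>m. U (diagseq m) i)" for i
  proof -
    have "convergent (\<lambda>m. U ((diagseq \<circ> (+) (Suc i)) m) i)"
    proof (rule diagseq_holds)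
      fix r s :: "nat \<Rightarrow> nat" and n
      assume "strict_mono r" "convergent (\<lambda>m. U (s m) n)"
      thus "convergent (\<lambda>m. U ((s \<circ> r) m) n)"
        using convergent_subseq_convergent[of "\<lambda>m. U (s m) n" r] by (simp add: o_def)
    qed
    hence "convergent (\<lambda>m. U (diagseq (m + Suc i)) i)" by (simp add: o_def add.commute)
    thus ?thesis by (subst (asm) convergent_ignore_initial_segment)
  qed
  hence "(\<lambda>m. U (diagseq m) i) \<longlonglongrightarrow> lim (\<lambda>m. U (diagseq m) i)" for i
    by (simp add: convergent_LIMSEQ_iff)
  thus ?thesis
    using subseq_diagseq by (intro exI[of _ diagseq] exI[of _ "\<lambda>i. lim (\<lambda>m. U (diagseq m) i)"]) simp
qed

text \<open>
  The bound depends on the majorant \<open>B\<close> only; it allows an interchange of the limit of the product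
  with a limit of the factors.
\<close>

lemma prod_tail_bound:
  fixes z :: complex and v B :: "nat \<Rightarrow> real"
  assumes "\<And>i. 0 \<le> v i" "\<And>i. v i \<le> B i" "summable B" "N \<le> n"
  shows "norm ((\<Prod>i<n. 1 - of_real (v i) * z) - (\<Prod>i<N. 1 - of_real (v i) * z))
     \<le> exp (norm z * suminf B) * (exp (norm z * (\<Sum>i. B (i + N))) - 1)"
proof -
  let ?f = "\<lambda>i. 1 - of_real (v i) * z"
  have B: "0 \<le> B i" for i using assms(1,2)[of i] by linarith
  have vB: "norm (of_real (v i) * z) \<le> norm z * B i" for i
    using assms(1,2)[of i] by (simp add: norm_mult) (metis mult.commute mult_left_mono norm_ge_zero)
  have "norm (\<Prod>i<N. ?f i) = (\<Prod>i<N. norm (?f i))" by (simp add: prod_norm)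
  also have "\<dots> \<le> (\<Prod>i<N. 1 + norm z * B i)"
  proof (intro prod_mono conjI)
    fix i show "norm (?f i) \<le> 1 + norm z * B i"
      using norm_triangle_ineq4[of 1 "of_real (v i) * z"] vB[of i] by simp
  qed auto
  also have "\<dots> \<le> exp (\<Sum>i<N. norm z * B i)"
    by (rule prod_le_exp_sum) (simp add: B)
  also have "\<dots> \<le> exp (norm z * suminf B)"
    using B assms(3) by (simp add: mult_left_mono sum_le_suminf flip: sum_distrib_left)
  finally have head: "norm (\<Prod>i<N. ?f i) \<le> exp (norm z * suminf B)" .
  have "norm ((\<Prod>i\<in>{N..<n}. ?f i) - 1) \<le> (\<Prod>i\<in>{N..<n}. 1 + norm (- (of_real (v i) * z))) - 1"
    using norm_prod_minus1_le_prod_minus1[of "\<lambda>i. - (of_real (v i) * z)" "{N..<n}"] by simp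
  also have "(\<Prod>i\<in>{N..<n}. 1 + norm (- (of_real (v i) * z))) \<le> exp (\<Sum>i\<in>{N..<n}. norm (- (of_real (v i) * z)))"
    by (rule prod_le_exp_sum) simp
  also have "\<dots> \<le> exp (\<Sum>i\<in>{N..<n}. norm z * B i)"
    using vB by (simp add: sum_mono)
  also have "(\<Sum>i\<in>{N..<n}. norm z * B i) = norm z * (\<Sum>i<n - N. B (i + N))"
    using assms(4) sum.shift_bounds_nat_ivl[of B 0 N "n - N"]
    by (simp add: atLeast0LessThan flip: sum_distrib_left)
  also have "\<dots> \<le> norm z * (\<Sum>i. B (i + N))"
    using B assms(3) by (intro mult_left_mono sum_le_suminf) (auto simp: summable_iff_shift)
  finally have tail: "norm ((\<Prod>i\<in>{N..<n}. ?f i) - 1) \<le> exp (norm z * (\<Sum>i. B (i + N))) - 1"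
    by simp
  have "(\<Prod>i<n. ?f i) = (\<Prod>i<N. ?f i) * (\<Prod>i\<in>{N..<n}. ?f i)"
    using prod.atLeastLessThan_concat[of 0 N n ?f] assms(4) by (simp add: atLeast0LessThan)
  hence "(\<Prod>i<n. ?f i) - (\<Prod>i<N. ?f i) = (\<Prod>i<N. ?f i) * ((\<Prod>i\<in>{N..<n}. ?f i) - 1)"
    by (simp add: algebra_simps)
  thus ?thesis
    using mult_mono[OF head tail] by (simp add: norm_mult)
qed

text \<open>
  If the reciprocal zeros of genus zero products have a common summable majorant, then a pointwise
  limit of these products is again such a product. A diagonal subsequence makes the reciprocal
  zeros converge one by one. By \<open>prod_tail_bound\<close> no mass escapes to the tails, so no factor
  \<open>exp (- c z)\<close> can appear. Zeros that disappear to infinity leave entries \<open>u i = 0\<close>.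
\<close>

lemma product_compactness:
  fixes U :: "nat \<Rightarrow> nat \<Rightarrow> real" and g :: "nat \<Rightarrow> complex \<Rightarrow> complex"
  assumes U: "\<And>m i. 0 \<le> U m i" "\<And>m i. U m i \<le> B i" and B: "summable B"
    and dec: "\<And>m. decseq (U m)"
    and prod: "\<And>m z. (\<lambda>n. \<Prod>i<n. 1 - of_real (U m i) * z) \<longlonglongrightarrow> g m z"
    and lim: "\<And>z. (\<lambda>m. g m z) \<longlonglongrightarrow> f z"
  shows "\<exists>u. (\<forall>i. 0 \<le> u i) \<and> summable u \<and> decseq u \<and>
    (\<forall>z. (\<lambda>n. \<Prod>i<n. 1 - of_real (u i) * z) \<longlonglongrightarrow> f z)"
proof -
  from diagonal_subsequence[of U, OF U]
  obtain d u where d: "strict_mono d" "\<And>i. (\<lambda>m. U (d m) i) \<longlonglongrightarrow> u i"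
    by auto
  have u: "0 \<le> u i" "u i \<le> B i" for i
    using d(2)[of i] U by (auto intro: tendsto_lowerbound tendsto_upperbound)
  have "decseq u"
    unfolding decseq_def
  proof (intro allI impI)
    fix i j :: nat assume "i \<le> j"
    thus "u j \<le> u i"
      using dec by (intro tendsto_le[OF _ d(2)[of i] d(2)[of j]]) (auto simp: decseq_def)
  qed
  moreover have "summable u"
    by (rule summable_comparison_test'[OF B, of 0]) (use u in auto)
  moreover have "(\<lambda>n. \<Prod>i<n. 1 - of_real (u i) * z) \<longlonglongrightarrow> f z" for z
  proof -
    define \<tau> where "\<tau> N = exp (norm z * suminf B) * (exp (norm z * (\<Sum>i. B (i + N))) - 1)" for N
    have "\<tau> \<longlonglongrightarrow> exp (norm z * suminf B) * (exp (norm z * 0) - 1)"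
      unfolding \<tau>_def by (intro tendsto_intros suminf_exist_split2 B)
    hence \<tau>: "\<tau> \<longlonglongrightarrow> 0" by simp
    have "norm (f z - (\<Prod>i<N. 1 - of_real (u i) * z)) \<le> \<tau> N" for N
    proof (rule tendsto_upperbound)
      show "(\<lambda>m. norm (g (d m) z - (\<Prod>i<N. 1 - of_real (U (d m) i) * z))) \<longlonglongrightarrow>
        norm (f z - (\<Prod>i<N. 1 - of_real (u i) * z))"
        using LIMSEQ_subseq_LIMSEQ[OF lim d(1), unfolded o_def]
        by (intro tendsto_intros d(2))
      have "norm (g m z - (\<Prod>i<N. 1 - of_real (U m i) * z)) \<le> \<tau> N" for m
      proof (rule tendsto_upperbound)
        show "(\<lambda>n. norm ((\<Prod>i<n. 1 - of_real (U m i) * z) - (\<Prod>i<N. 1 - of_real (U m i) * z))) \<longlonglongrightarrow>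
          norm (g m z - (\<Prod>i<N. 1 - of_real (U m i) * z))"
          by (intro tendsto_intros prod)
        show "\<forall>\<^sub>F n in sequentially. norm ((\<Prod>i<n. 1 - of_real (U m i) * z) - (\<Prod>i<N. 1 - of_real (U m i) * z)) \<le> \<tau> N"
          using eventually_ge_at_top[of N]
          by eventually_elim (use U B in \<open>auto simp: \<tau>_def intro!: prod_tail_bound\<close>)
      qed auto
      thus "\<forall>\<^sub>F m in sequentially. norm (g (d m) z - (\<Prod>i<N. 1 - of_real (U (d m) i) * z)) \<le> \<tau> N"
        by simp
    qed auto
    hence "(\<lambda>N. f z - (\<Prod>i<N. 1 - of_real (u i) * z)) \<longlonglongrightarrow> 0"
      by (intro Lim_null_comparison[OF _ \<tau>]) auto
    from tendsto_diff[OF tendsto_const[of "f z"] this] show ?thesis by simp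
  qed
  ultimately show ?thesis using u(1) by (intro exI[of _ u]) simp
qed

lemma hyper_0F_limit_product:
  assumes pos: "\<And>a. a \<in> set as \<Longrightarrow> a > 0" and ne: "as \<noteq> []"
  shows "\<exists>u :: nat \<Rightarrow> real. (\<forall>i. 0 \<le> u i) \<and> summable u \<and> decseq u \<and>
    (\<forall>z. (\<lambda>n. \<Prod>i<n. 1 - of_real (u i) * z) \<longlonglongrightarrow> hyper_0F as (- z))"
proof -
  obtain K where K: "K > 0" "\<And>m n. m \<ge> 1 \<Longrightarrow> 0 \<le> approx_coeff as m n"
    "\<And>m n. m \<ge> 1 \<Longrightarrow> approx_coeff as m n \<le> K ^ n / (fact n)\<^sup>2"
    using approx_coeff_bound[OF pos ne] by metis
  define B where "B i = exp (2 * sqrt K) / (real i + 1)\<^sup>2" for i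
  define g where "g m z = (\<Sum>n. of_real (approx_coeff as (Suc m) n) * (- z) ^ n)" for m and z :: complex
  have "\<forall>m. \<exists>u. (\<forall>i. 0 \<le> u i \<and> u i \<le> B i) \<and> decseq u \<and>
      (\<forall>z. (\<lambda>n. \<Prod>i<n. 1 - of_real (u i) * z) \<longlonglongrightarrow> g m z)"
  proof
    fix m :: nat
    have "1 \<le> Suc m" by simp
    from approximant_factorization[OF pos this K(1) K(2,3)[OF this]]
    show "\<exists>u. (\<forall>i. 0 \<le> u i \<and> u i \<le> B i) \<and> decseq u \<and>
      (\<forall>z. (\<lambda>n. \<Prod>i<n. 1 - of_real (u i) * z) \<longlonglongrightarrow> g m z)"
      unfolding B_def g_def .
  qed
  from choice[OF this]
  obtain U where U: "\<And>m i. 0 \<le> U m i" "\<And>m i. U m i \<le> B i" "\<And>m. decseq (U m)"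
    "\<And>m z. (\<lambda>n. \<Prod>i<n. 1 - of_real (U m i) * z) \<longlonglongrightarrow> g m z"
    by blast
  have B: "summable B"
  proof -
    have "summable (\<lambda>i. 1 / (real (Suc i))\<^sup>2)"
      using inverse_power_summable[of 2, where ?'a = real] by (subst summable_Suc_iff) (simp add: inverse_eq_divide)
    from summable_mult[OF this, of "exp (2 * sqrt K)"] show ?thesis
      by (simp add: B_def[abs_def] add.commute)
  qed
  have lim: "(\<lambda>m. g m z) \<longlonglongrightarrow> hyper_0F as (- z)" for z
    unfolding g_def
    using approximants_converge(2)[OF pos K(2,3,1), of "- z"] by (rule LIMSEQ_Suc)
  from product_compactness[of U, OF U(1,2) B U(3,4) lim] show ?thesis .
qed

lemma hyper_coeff_pos:
  assumes "\<And>a. a \<in> set as \<Longrightarrow> a > 0"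
  shows "hyper_coeff as n > 0"
proof -
  have "(\<Prod>a\<leftarrow>as. pochhammer a n) > 0"
    using assms by (induction as) (auto intro!: mult_pos_pos pochhammer_pos)
  thus ?thesis by (simp add: hyper_coeff_def)
qed

lemma hyper_0F_sums:
  assumes "\<And>a. a \<in> set as \<Longrightarrow> a > 0" "as \<noteq> []"
  shows "(\<lambda>n. of_real (hyper_coeff as n) * z ^ n) sums hyper_0F as z"
proof -
  obtain K where K: "K > 0" "\<And>m n. m \<ge> 1 \<Longrightarrow> 0 \<le> approx_coeff as m n"
    "\<And>m n. m \<ge> 1 \<Longrightarrow> approx_coeff as m n \<le> K ^ n / (fact n)\<^sup>2"
    using approx_coeff_bound[OF assms] by metis
  from approximants_converge(1)[OF assms(1) K(2,3,1), of z]
  show ?thesis unfolding hyper_0F_def by (rule summable_sums[OF summable_norm_cancel])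
qed

text \<open>
  A vanishing \<open>u N\<close> would make all later entries vanish and the function a polynomial of degree at
  most \<open>N\<close>. The coefficients of the series are all positive, so it outgrows every polynomial on the
  positive axis.
\<close>

theorem hyper_0F_has_prod:
  assumes pos: "\<And>a. a \<in> set as \<Longrightarrow> a > 0" and ne: "as \<noteq> []"
  shows "\<exists>u :: nat \<Rightarrow> real. (\<forall>i. 0 < u i) \<and> summable u \<and> decseq u \<and>
    (\<forall>z. (\<lambda>i. 1 - of_real (u i) * z) has_prod hyper_0F as (- z))"
proof -
  from hyper_0F_limit_product[OF assms]
  obtain u :: "nat \<Rightarrow> real" where u: "\<And>i. 0 \<le> u i" "summable u" "decseq u"
    "\<And>z. (\<lambda>n. \<Prod>i<n. 1 - of_real (u i) * z) \<longlonglongrightarrow> hyper_0F as (- z)"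
    by auto
  have "0 < u N" for N
  proof (rule ccontr)
    assume "\<not> 0 < u N"
    hence zero: "u i = 0" if "i \<ge> N" for i
      using u(1)[of i] u(1)[of N] decseqD[OF u(3) that] by linarith
    define c where "c = hyper_coeff as (Suc N)"
    have "c > 0" unfolding c_def by (rule hyper_coeff_pos[OF pos])
    have "c * x \<le> (1 + u 0) ^ N" if x: "x \<ge> 1" for x
    proof -
      have "(\<lambda>n. hyper_coeff as n * x ^ n) sums Re (hyper_0F as (of_real x))"
        using sums_Re[OF hyper_0F_sums[OF assms, of "of_real x"]] by (simp flip: of_real_power of_real_mult)
      moreover have "0 \<le> hyper_coeff as n * x ^ n" for n
        using x hyper_coeff_pos[OF pos, of as n] by simp
      ultimately have "(\<Sum>n\<in>{Suc N}. hyper_coeff as n * x ^ n) \<le> Re (hyper_0F as (of_real x))"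
        using sum_le_suminf[of "\<lambda>n. hyper_coeff as n * x ^ n" "{Suc N}"] unfolding sums_iff by simp
      hence "c * x ^ Suc N \<le> Re (hyper_0F as (of_real x))" by (simp add: c_def)
      also have "hyper_0F as (of_real x) = (\<Prod>i<N. 1 - of_real (u i) * (- of_real x))"
      proof (rule LIMSEQ_unique)
        show "(\<lambda>n. \<Prod>i<n. 1 - of_real (u i) * (- of_real x)) \<longlonglongrightarrow> hyper_0F as (of_real x)"
          using u(4)[of "- of_real x"] by simp
        have "eventually (\<lambda>n. (\<Prod>i<n. 1 - of_real (u i) * (- complex_of_real x)) =
            (\<Prod>i<N. 1 - of_real (u i) * (- of_real x))) sequentially"
          using eventually_ge_at_top[of N]
        proof eventually_elim
          case (elim n)
          thus ?case using zero by (intro prod.mono_neutral_right) auto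
        qed
        thus "(\<lambda>n. \<Prod>i<n. 1 - of_real (u i) * (- complex_of_real x)) \<longlonglongrightarrow>
            (\<Prod>i<N. 1 - of_real (u i) * (- of_real x))"
          by (rule tendsto_eventually)
      qed
      also have "Re \<dots> = (\<Prod>i<N. 1 + u i * x)"
      proof -
        have "(\<Prod>i<N. 1 - of_real (u i) * (- complex_of_real x)) = of_real (\<Prod>i<N. 1 + u i * x)" by simp
        thus ?thesis by (simp only: Re_complex_of_real)
      qed
      also have "\<dots> \<le> (\<Prod>i<N. (1 + u 0) * x)"
      proof (intro prod_mono conjI)
        fix i
        have "u i * x \<le> u 0 * x"
          using decseqD[OF u(3), of 0 i] x by (intro mult_right_mono) auto
        thus "1 + u i * x \<le> (1 + u 0) * x" using x unfolding ring_distribs by linarith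
        show "0 \<le> 1 + u i * x" using u(1)[of i] x by simp
      qed
      finally have "(c * x) * x ^ N \<le> (1 + u 0) ^ N * x ^ N"
        by (simp add: power_mult_distrib mult_ac)
      thus ?thesis using x by simp
    qed
    note bound = this
    \<comment> \<open>The first summand alone gives equality in the bound, so the second one contradicts it.\<close>
    define x where "x = (1 + u 0) ^ N / c + 1"
    have "c * x = (1 + u 0) ^ N + c" using \<open>c > 0\<close> by (simp add: x_def field_simps)
    moreover have "x \<ge> 1" using \<open>c > 0\<close> u(1)[of 0] by (simp add: x_def)
    ultimately show False using bound[of x] \<open>c > 0\<close> by simp
  qed
  moreover have "(\<lambda>i. 1 - of_real (u i) * z) has_prod hyper_0F as (- z)" for z
  proof (rule convergent_prod_tendsto_imp_has_prod)
    have "summable (\<lambda>i. norm z * u i)" using u(2) by (rule summable_mult)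
    hence "summable (\<lambda>i. norm ((1 - of_real (u i) * z) - 1))"
      using u(1) by (simp add: norm_mult mult.commute)
    thus "convergent_prod (\<lambda>i. 1 - of_real (u i) * z)"
      by (intro abs_convergent_prod_imp_convergent_prod summable_imp_abs_convergent_prod)
    show "(\<lambda>n. \<Prod>i\<le>n. 1 - of_real (u i) * z) \<longlonglongrightarrow> hyper_0F as (- z)"
      using LIMSEQ_Suc[OF u(4)[of z]] by (simp add: lessThan_Suc_atMost)
  qed
  ultimately show ?thesis using u(2,3) by (intro exI[of _ u]) simp
qed

section \<open>Enumeration of simple zeros\<close>

text \<open>
  Two equal factors force the product to vanish to second order at their common zero.
\<close>

lemma double_factor_bound:
  fixes u :: "nat \<Rightarrow> real" and z :: complex
  assumes u: "\<And>i. 0 \<le> u i" "summable u" and eq: "i \<noteq> j" "u i = u j"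
    and prod: "(\<lambda>i. 1 - of_real (u i) * z) has_prod P"
  shows "norm P \<le> (norm (1 - of_real (u i) * z))\<^sup>2 * exp (norm z * suminf u)"
proof (rule tendsto_upperbound)
  let ?f = "\<lambda>i. 1 - of_real (u i) * z"
  show "(\<lambda>n. norm (\<Prod>k\<le>n. ?f k)) \<longlonglongrightarrow> norm P"
    by (intro tendsto_norm has_prod_imp_tendsto prod)
  show "\<forall>\<^sub>F n in sequentially. norm (\<Prod>k\<le>n. ?f k) \<le> (norm (?f i))\<^sup>2 * exp (norm z * suminf u)"
    using eventually_ge_at_top[of "max i j"]
  proof eventually_elim
    case (elim n)
    let ?R = "{..n} - {i, j}"
    have "(\<Prod>k\<le>n. ?f k) = ?f i * (\<Prod>k\<in>{..n} - {i}. ?f k)"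
      using elim by (intro prod.remove) auto
    also have "(\<Prod>k\<in>{..n} - {i}. ?f k) = ?f j * (\<Prod>k\<in>{..n} - {i} - {j}. ?f k)"
      using elim eq by (intro prod.remove) auto
    also have "{..n} - {i} - {j} = ?R" by auto
    finally have "norm (\<Prod>k\<le>n. ?f k) = (norm (?f i))\<^sup>2 * (\<Prod>k\<in>?R. norm (?f k))"
      using eq by (simp add: norm_mult prod_norm power2_eq_square)
    also have "(\<Prod>k\<in>?R. norm (?f k)) \<le> (\<Prod>k\<in>?R. 1 + norm z * u k)"
    proof (intro prod_mono conjI)
      fix k show "norm (?f k) \<le> 1 + norm z * u k"
        using norm_triangle_ineq4[of 1 "of_real (u k) * z"] u(1)[of k] by (simp add: norm_mult mult.commute)
    qed auto
    also have "\<dots> \<le> exp (\<Sum>k\<in>?R. norm z * u k)"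
      by (rule prod_le_exp_sum) (simp add: u)
    also have "\<dots> \<le> exp (norm z * suminf u)"
      using u by (simp add: mult_left_mono sum_le_suminf flip: sum_distrib_left)
    finally show ?case by (simp add: mult_left_mono)
  qed
qed auto

text \<open>
  The product lists the zeros with multiplicity and in decreasing order of their reciprocals.
  A nonzero derivative along the positive axis rules out the quadratic bound of
  \<open>double_factor_bound\<close>, so this order is strict, and the reciprocals of the entries enumerate the
  positive zeros in increasing order.
\<close>

lemma hyper_0F_simple_zeros:
  assumes pos: "\<And>a. a \<in> set as \<Longrightarrow> a > 0" and ne: "as \<noteq> []"
    and simple: "\<And>x. 0 < x \<Longrightarrow> hyper_0F as (- of_real x) = 0 \<Longrightarrow>
      \<exists>D. D \<noteq> 0 \<and> ((\<lambda>t. Re (hyper_0F as (- of_real t))) has_real_derivative D) (at x)"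
  shows "\<exists>e :: nat \<Rightarrow> real. (\<forall>i. 0 < e i) \<and> strict_mono e \<and>
    range e = {x. 0 < x \<and> hyper_0F as (- of_real x) = 0} \<and>
    (\<forall>z. (\<lambda>i. 1 - z / of_real (e i)) has_prod hyper_0F as (- z))"
proof -
  define f where "f z = hyper_0F as (- z)" for z
  from hyper_0F_has_prod[OF pos ne] obtain u :: "nat \<Rightarrow> real" where
    u: "\<And>i. 0 < u i" "summable u" "decseq u"
      "\<And>z. (\<lambda>i. 1 - of_real (u i) * z) has_prod f z"
    unfolding f_def by auto
  have inj: "u i \<noteq> u j" if "i \<noteq> j" for i j
  proof
    assume eq: "u i = u j"
    define x where "x = 1 / u i"
    have "x > 0" using u(1) by (simp add: x_def)
    have ux: "1 - of_real (u i) * complex_of_real x = 0"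
      using u(1)[of i] by (simp add: x_def)
    hence fx: "f (of_real x) = 0"
      by (intro has_prod_zeroI[OF u(4)[of "of_real x"], of i])
    obtain D where "D \<noteq> 0" and D: "((\<lambda>t. Re (f (of_real t))) has_real_derivative D) (at x)"
      using simple[OF \<open>x > 0\<close>] fx by (auto simp: f_def)
    have "((\<lambda>t. Re (f (of_real t)) / (t - x)) \<longlongrightarrow> D) (at x)"
      using D fx by (simp add: has_field_derivative_iff)
    moreover have "((\<lambda>t. Re (f (of_real t)) / (t - x)) \<longlongrightarrow> 0) (at x)"
    proof (rule Lim_null_comparison)
      show "((\<lambda>t. \<bar>t - x\<bar> * ((u i)\<^sup>2 * exp (\<bar>t\<bar> * suminf u))) \<longlongrightarrow> 0) (at x)"
        by (auto intro!: tendsto_eq_intros)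
      show "\<forall>\<^sub>F t in at x. norm (Re (f (of_real t)) / (t - x)) \<le>
          \<bar>t - x\<bar> * ((u i)\<^sup>2 * exp (\<bar>t\<bar> * suminf u))"
        using eventually_neq_at_within[of x x UNIV]
      proof eventually_elim
        case (elim t)
        have "1 - of_real (u i) * complex_of_real t = of_real (u i * (x - t))"
          using u(1)[of i] by (simp add: x_def field_simps)
        hence "(norm (1 - of_real (u i) * complex_of_real t))\<^sup>2 = (u i)\<^sup>2 * (t - x)\<^sup>2"
          by (simp only: norm_of_real) (simp add: power_mult_distrib power2_commute)
        hence "norm (f (of_real t)) \<le> (u i)\<^sup>2 * (t - x)\<^sup>2 * exp (\<bar>t\<bar> * suminf u)"
          using double_factor_bound[OF less_imp_le[OF u(1)] u(2) that eq u(4)[of "of_real t"]] by simp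
        hence "\<bar>Re (f (of_real t))\<bar> \<le> (u i)\<^sup>2 * (t - x)\<^sup>2 * exp (\<bar>t\<bar> * suminf u)"
          using abs_Re_le_cmod order.trans by blast
        also have "\<dots> = (\<bar>t - x\<bar> * ((u i)\<^sup>2 * exp (\<bar>t\<bar> * suminf u))) * \<bar>t - x\<bar>"
          by (simp add: power2_eq_square abs_mult_self_eq mult_ac)
        finally show ?case using elim by (simp add: abs_divide divide_le_eq)
      qed
    qed
    ultimately have "D = 0" by (rule LIM_unique)
    thus False using \<open>D \<noteq> 0\<close> by simp
  qed
  define e where "e i = 1 / u i" for i
  have e_pos: "0 < e i" for i using u(1) by (simp add: e_def)
  have ue: "of_real (u i) * z = z / complex_of_real (e i)" for i z by (simp add: e_def)
  have "strict_mono e"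
    unfolding strict_mono_def
  proof (intro allI impI)
    fix i j :: nat assume "i < j"
    hence "u j < u i" using inj[of i j] decseqD[OF u(3), of i j] by simp
    thus "e i < e j" using u(1)[of j] by (simp add: e_def frac_less2)
  qed
  moreover have "range e = {x. 0 < x \<and> f (of_real x) = 0}"
  proof -
    have "f (of_real x) = 0 \<longleftrightarrow> x \<in> range e" if "x > 0" for x
    proof -
      have "f (of_real x) = 0 \<longleftrightarrow> (\<exists>i. 0 = 1 - complex_of_real (u i) * of_real x)"
        using has_prod_eq_0_iff[OF u(4)[of "of_real x"]] by auto
      also have "\<dots> \<longleftrightarrow> (\<exists>i. u i * x = 1)"
        by (simp flip: of_real_mult)
      also have "\<dots> \<longleftrightarrow> x \<in> range e"
      proof -
        have "u i * x = 1 \<longleftrightarrow> x = e i" for i using u(1)[of i] by (auto simp: e_def field_simps)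
        thus ?thesis by auto
      qed
      finally show ?thesis .
    qed
    thus ?thesis using e_pos by auto
  qed
  ultimately show ?thesis using e_pos u(4) unfolding ue f_def by blast
qed

section \<open>The entire parts of the Bessel functions and of their cross-product\<close>

definition bessel_coeff :: "real \<Rightarrow> nat \<Rightarrow> real" where
  "bessel_coeff \<nu> n = rGamma (\<nu> + real n + 1) / fact n"

text \<open>
  With \<open>w = (z / 2)\<^sup>2\<close>, the Bessel functions of order \<open>\<nu>\<close> are \<open>(z / 2) powr \<nu>\<close> times this function at
  \<open>- w\<close> and at \<open>w\<close>. It is polymorphic because the product formula lives on the complex plane while
  the interlacing argument is about functions of a real variable.
\<close>

definition bessel_entire :: "real \<Rightarrow> 'a :: {real_normed_field, banach} \<Rightarrow> 'a" where
  "bessel_entire \<nu> w = (\<Sum>n. of_real (bessel_coeff \<nu> n) * w ^ n)"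

lemma bessel_coeff_eq_hyper_coeff:
  assumes "\<nu> > -1"
  shows "bessel_coeff \<nu> n = rGamma (\<nu> + 1) * hyper_coeff [\<nu> + 1] n"
proof -
  have "pochhammer (\<nu> + 1) n > 0" using assms by (intro pochhammer_pos) auto
  moreover have "rGamma (\<nu> + 1) = pochhammer (\<nu> + 1) n * rGamma (\<nu> + real n + 1)"
    using pochhammer_rGamma[of "\<nu> + 1" n] by (simp add: add_ac)
  ultimately show ?thesis by (simp add: bessel_coeff_def hyper_coeff_def field_simps)
qed

lemma bessel_coeff_Suc: "real (Suc n) * bessel_coeff \<nu> (Suc n) = bessel_coeff (\<nu> + 1) n"
proof -
  have "\<nu> + real (Suc n) + 1 = \<nu> + 1 + real n + 1" by simp
  from arg_cong[OF this, of rGamma] show ?thesis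
    unfolding bessel_coeff_def fact_Suc by (simp del: of_nat_Suc)
qed

lemma bessel_coeff_recurrence:
  "(real n + \<nu> + 1) * bessel_coeff (\<nu> + 1) n = bessel_coeff \<nu> n"
  using rGamma_plus1[of "\<nu> + real n + 1"] by (simp add: bessel_coeff_def add_ac field_simps)

lemma bessel_entire_abs_summable:
  fixes w :: "'a :: {real_normed_field, banach}"
  assumes "\<nu> > -1"
  shows "summable (\<lambda>n. norm (of_real (bessel_coeff \<nu> n) * w ^ n))"
proof -
  have pos: "a > 0" if "a \<in> set [\<nu> + 1]" for a using assms that by auto
  obtain K where K: "K > 0" "\<And>m n. m \<ge> 1 \<Longrightarrow> 0 \<le> approx_coeff [\<nu> + 1] m n"
    "\<And>m n. m \<ge> 1 \<Longrightarrow> approx_coeff [\<nu> + 1] m n \<le> K ^ n / (fact n)\<^sup>2"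
    using approx_coeff_bound[OF pos] by (metis list.distinct(1))
  from approximants_converge(1)[OF pos K(2,3,1), of "of_real (norm w)"]
  have "summable (\<lambda>n. \<bar>hyper_coeff [\<nu> + 1] n\<bar> * norm w ^ n)"
    by (simp add: norm_mult norm_power)
  from summable_mult[OF this, of "\<bar>rGamma (\<nu> + 1)\<bar>"] show ?thesis
    using assms by (simp add: bessel_coeff_eq_hyper_coeff norm_mult norm_power abs_mult mult.assoc)
qed

lemma bessel_entire_sums:
  assumes "\<nu> > -1"
  shows "(\<lambda>n. of_real (bessel_coeff \<nu> n) * w ^ n) sums bessel_entire \<nu> w"
  unfolding bessel_entire_def
  using summable_sums[OF summable_norm_cancel[OF bessel_entire_abs_summable[OF assms, of w]]] .

lemma bessel_entire_of_real:
  fixes t :: real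
  assumes "\<nu> > -1"
  shows "bessel_entire \<nu> (of_real t :: 'b :: {real_normed_field, banach}) = of_real (bessel_entire \<nu> t)"
proof (rule sums_unique2[OF bessel_entire_sums[OF assms]])
  have "(\<lambda>n. bessel_coeff \<nu> n * t ^ n) sums bessel_entire \<nu> t"
    using bessel_entire_sums[OF assms, of t] by simp
  hence "(\<lambda>n. of_real (bessel_coeff \<nu> n * t ^ n) :: 'b) sums of_real (bessel_entire \<nu> t)"
    by (rule sums_of_real)
  thus "(\<lambda>n. of_real (bessel_coeff \<nu> n) * of_real t ^ n :: 'b) sums of_real (bessel_entire \<nu> t)"
    by simp
qed

lemma bessel_entire_eq_hyper_0F:
  assumes "\<nu> > -1"
  shows "bessel_entire \<nu> w = of_real (rGamma (\<nu> + 1)) * hyper_0F [\<nu> + 1] w"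
proof -
  have "(\<lambda>n. of_real (rGamma (\<nu> + 1)) * (of_real (hyper_coeff [\<nu> + 1] n) * w ^ n)) sums
      (of_real (rGamma (\<nu> + 1)) * hyper_0F [\<nu> + 1] w)"
    using assms by (intro sums_mult hyper_0F_sums) auto
  with bessel_entire_sums[OF assms, of w] show ?thesis
    using assms by (simp add: bessel_coeff_eq_hyper_coeff mult.assoc sums_unique2)
qed

lemma bessel_entire_pos:
  fixes t :: real
  assumes "\<nu> > -1" "t \<ge> 0"
  shows "bessel_entire \<nu> t > 0"
proof -
  have coeff: "bessel_coeff \<nu> n > 0" for n
    using assms Gamma_real_pos[of "\<nu> + real n + 1"] by (simp add: bessel_coeff_def rGamma_inverse_Gamma)
  have "0 < (\<Sum>n\<in>{0}. bessel_coeff \<nu> n * t ^ n)" using coeff[of 0] by simp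
  also have "\<dots> \<le> bessel_entire \<nu> t"
    using bessel_entire_sums[OF assms(1), of t] sum_le_suminf[of "\<lambda>n. bessel_coeff \<nu> n * t ^ n" "{0}"]
      coeff assms(2) by (simp add: sums_iff less_imp_le)
  finally show ?thesis .
qed

lemma bessel_entire_deriv:
  fixes w :: "'a :: {real_normed_field, banach}"
  assumes "\<nu> > -1"
  shows "(bessel_entire \<nu> has_field_derivative bessel_entire (\<nu> + 1) w) (at w)"
proof -
  have "((\<lambda>w. \<Sum>n. of_real (bessel_coeff \<nu> n) * w ^ n) has_field_derivative
      (\<Sum>n. diffs (\<lambda>n. of_real (bessel_coeff \<nu> n)) n * w ^ n)) (at w)"
    using bessel_entire_sums[OF assms] by (intro termdiffs_strong_converges_everywhere sums_summable)
  moreover have "diffs (\<lambda>n. of_real (bessel_coeff \<nu> n) :: 'a) n = of_real (bessel_coeff (\<nu> + 1) n)" for n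
    unfolding diffs_def bessel_coeff_Suc [symmetric] by simp
  ultimately show ?thesis by (simp add: bessel_entire_def[abs_def])
qed

lemma bessel_entire_recurrence:
  fixes w :: "'a :: {real_normed_field, banach}"
  assumes "\<nu> > -1"
  shows "w * bessel_entire (\<nu> + 2) w + of_real (\<nu> + 1) * bessel_entire (\<nu> + 1) w = bessel_entire \<nu> w"
proof -
  let ?f = "\<lambda>n. of_nat n * (of_real (bessel_coeff (\<nu> + 1) n) * w ^ n)"
  have f_Suc: "?f (Suc n) = w * (of_real (bessel_coeff (\<nu> + 2) n) * w ^ n)" for n
  proof -
    have "bessel_coeff (\<nu> + 2) n = real (Suc n) * bessel_coeff (\<nu> + 1) (Suc n)"
      using bessel_coeff_Suc[of n "\<nu> + 1"] by (simp add: add_ac)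
    thus ?thesis by (simp add: mult_ac)
  qed
  have "(\<lambda>n. ?f (Suc n)) sums (w * bessel_entire (\<nu> + 2) w)"
    unfolding f_Suc using assms by (intro sums_mult bessel_entire_sums) simp
  from sums_Suc[OF this] have "?f sums (w * bessel_entire (\<nu> + 2) w)" by simp
  from sums_add[OF this sums_mult[OF bessel_entire_sums[of "\<nu> + 1" w], of "of_real (\<nu> + 1)"]] assms
  have "(\<lambda>n. ?f n + of_real (\<nu> + 1) * (of_real (bessel_coeff (\<nu> + 1) n) * w ^ n)) sums
      (w * bessel_entire (\<nu> + 2) w + of_real (\<nu> + 1) * bessel_entire (\<nu> + 1) w)" by simp
  moreover have "?f n + of_real (\<nu> + 1) * (of_real (bessel_coeff (\<nu> + 1) n) * w ^ n) =
      of_real (bessel_coeff \<nu> n) * w ^ n" for n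
    unfolding bessel_coeff_recurrence [of n \<nu>, symmetric] by (simp add: ring_distribs mult_ac)
  ultimately show ?thesis
    using bessel_entire_sums[OF assms, of w] by (simp add: sums_unique2)
qed

text \<open>
  The cross-product divided by \<open>(z / 2) powr (2 * \<nu> + 1)\<close>, as a function of \<open>(z / 2)\<^sup>2\<close>.
\<close>

definition cross_entire :: "real \<Rightarrow> 'a :: {real_normed_field, banach} \<Rightarrow> 'a" where
  "cross_entire \<nu> w = bessel_entire (\<nu> + 1) (- w) * bessel_entire \<nu> w
                    + bessel_entire \<nu> (- w) * bessel_entire (\<nu> + 1) w"

text \<open>
  With \<open>k = \<nu> + 1\<close>, the four series below are \<open>bessel_entire\<close> of orders \<open>\<nu>\<close> and \<open>\<nu> + 1\<close> at \<open>- w\<close> (\<open>A\<close>, \<open>B\<close>)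
  and at \<open>w\<close> (\<open>C\<close>, \<open>D\<close>). The products \<open>A C\<close>, \<open>B D\<close> and \<open>B C \<plusminus> A D\<close> form a closed system under
  differentiation. Going once around the system expresses the coefficient \<open>n + 2\<close> of \<open>G\<close> by the
  coefficient \<open>n\<close>, a recurrence that the Cauchy product does not show.
\<close>

lemma cross_coefficients:
  fixes A B C D :: "complex fps" and k :: real
  assumes k: "k > 0"
    and A: "fps_deriv A = - B" and C: "fps_deriv C = D"
    and B: "fps_X * fps_deriv B = A - fps_const (of_real k) * B"
    and D: "fps_X * fps_deriv D = C - fps_const (of_real k) * D"
  defines "G \<equiv> B * C + A * D"
  shows "fps_nth G (2 * n + 1) = 0"
    and "fps_nth G (2 * n) =
      fps_nth G 0 * of_real (hyper_coeff [k, (k + 1) / 2, (k + 2) / 2] n) * (- 1 / 4) ^ n"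
proof -
  define P where "P = A * C"
  define Q where "Q = B * D"
  define H where "H = B * C - A * D"
  let ?k = "fps_const (complex_of_real k)"
  have eqs: "fps_deriv P = - H" "fps_X * fps_deriv G = 2 * P - ?k * G"
    "fps_X * fps_deriv H = 2 * (fps_X * Q) - ?k * H" "fps_X * fps_deriv Q = G - 2 * ?k * Q"
  proof -
    show "fps_deriv P = - H" by (simp add: P_def H_def A C)
    have "fps_X * fps_deriv G = (fps_X * fps_deriv B) * C + A * (fps_X * fps_deriv D)"
      by (simp add: G_def A C algebra_simps)
    also have "\<dots> = 2 * P - ?k * G"
      unfolding B D by (simp add: P_def G_def algebra_simps)
    finally show "fps_X * fps_deriv G = 2 * P - ?k * G" .
    have "fps_X * fps_deriv H = (fps_X * fps_deriv B) * C - A * (fps_X * fps_deriv D) + 2 * (fps_X * Q)"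
      by (simp add: H_def Q_def A C algebra_simps)
    also have "\<dots> = 2 * (fps_X * Q) - ?k * H"
      unfolding B D by (simp add: H_def algebra_simps)
    finally show "fps_X * fps_deriv H = 2 * (fps_X * Q) - ?k * H" .
    have "fps_X * fps_deriv Q = (fps_X * fps_deriv B) * D + B * (fps_X * fps_deriv D)"
      by (simp add: Q_def algebra_simps)
    also have "\<dots> = G - 2 * ?k * Q"
      unfolding B D by (simp add: Q_def G_def algebra_simps)
    finally show "fps_X * fps_deriv Q = G - 2 * ?k * Q" .
  qed
  have euler: "fps_nth (fps_X * fps_deriv f) n = of_nat n * fps_nth f n" for f :: "complex fps" and n
    by (cases n) (simp_all add: mult.commute)
  have two: "fps_nth (2 * f) n = 2 * fps_nth f n" for f :: "complex fps" and n
    by (simp add: fps_numeral_fps_const)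
  have p: "of_nat (Suc n) * fps_nth P (Suc n) = - fps_nth H n" for n
    using arg_cong[OF eqs(1), of "\<lambda>f. fps_nth f n"] by simp
  have g: "(of_nat n + of_real k) * fps_nth G n = 2 * fps_nth P n" for n
    using arg_cong[OF eqs(2), of "\<lambda>f. fps_nth f n", unfolded euler] by (simp add: two ring_distribs)
  have h: "(of_nat (Suc n) + of_real k) * fps_nth H (Suc n) = 2 * fps_nth Q n" for n
    using arg_cong[OF eqs(3), of "\<lambda>f. fps_nth f (Suc n)", unfolded euler] by (simp add: two ring_distribs)
  have "of_real k * fps_nth H 0 = 0"
    using arg_cong[OF eqs(3), of "\<lambda>f. fps_nth f 0", unfolded euler] by (simp add: two)
  hence h0: "fps_nth H 0 = 0" using k by simp
  have q: "(of_nat n + 2 * of_real k) * fps_nth Q n = fps_nth G n" for n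
    using arg_cong[OF eqs(4), of "\<lambda>f. fps_nth f n", unfolded euler]
    by (simp add: two ring_distribs mult.assoc)
  have nz: "of_nat n + complex_of_real x \<noteq> 0" if "x > 0" for n x
  proof -
    have "of_nat n + complex_of_real x = of_real (real n + x)" by simp
    thus ?thesis using that by (simp only: of_real_eq_0_iff)
  qed
  \<comment> \<open>Once around the system: from \<open>G\<close> to \<open>P\<close>, \<open>H\<close>, \<open>Q\<close> and back to \<open>G\<close>.\<close>
  have step: "fps_nth G (n + 2) * ((of_nat n + 2) * (of_nat n + 1 + of_real k) *
     (of_nat n + 2 + of_real k) * (of_nat n + 2 * of_real k)) = - 4 * fps_nth G n" for n
  proof -
    have "fps_nth G (n + 2) * ((of_nat n + 2) * (of_nat n + 1 + of_real k) *
       (of_nat n + 2 + of_real k) * (of_nat n + 2 * of_real k)) =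
       ((of_nat (n + 2) + of_real k) * fps_nth G (n + 2)) * ((of_nat n + 2) * (of_nat n + 1 + of_real k) * (of_nat n + 2 * of_real k))"
      by (simp add: mult_ac)
    also have "\<dots> = 2 * (of_nat (Suc (Suc n)) * fps_nth P (Suc (Suc n))) * ((of_nat n + 1 + of_real k) * (of_nat n + 2 * of_real k))"
      unfolding g by (simp add: algebra_simps)
    also have "\<dots> = - 2 * ((of_nat (Suc n) + of_real k) * fps_nth H (Suc n)) * (of_nat n + 2 * of_real k)"
      unfolding p by (simp add: algebra_simps)
    also have "\<dots> = - 4 * ((of_nat n + 2 * of_real k) * fps_nth Q n)"
      unfolding h by (simp add: algebra_simps)
    finally show ?thesis unfolding q .
  qed
  have nz4: "(of_nat n + 2) * (of_nat n + 1 + of_real k) *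
     (of_nat n + 2 + of_real k) * (of_nat n + 2 * complex_of_real k) \<noteq> 0" for n
    using nz[of "2 * k" n] nz[of "k + 1" n] nz[of "k + 2" n] nz[of 2 n] k by (simp add: add_ac)
  show "fps_nth G (2 * n + 1) = 0"
  proof (induction n)
    case 0
    have "fps_nth P 1 = 0" using p[of 0] h0 by simp
    thus ?case using g[of 1] nz[of k 1] k by simp
  next
    case (Suc n)
    thus ?case using step[of "2 * n + 1"] nz4[of "2 * n + 1"] by simp
  qed
  show "fps_nth G (2 * n) =
      fps_nth G 0 * of_real (hyper_coeff [k, (k + 1) / 2, (k + 2) / 2] n) * (- 1 / 4) ^ n"
  proof (induction n)
    case 0
    show ?case by (simp add: hyper_coeff_def)
  next
    case (Suc n)
    let ?h = "hyper_coeff [k, (k + 1) / 2, (k + 2) / 2]"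
    let ?q = "(2 * real n + 2) * (2 * n + 1 + k) * (2 * n + 2 + k) * (2 * n + 2 * k)"
    have pos: "?q > 0" using k by (intro mult_pos_pos) auto
    have "?h (Suc n) * ((real n + 1) * (k + n) * ((k + 1) / 2 + n) * ((k + 2) / 2 + n)) = ?h n"
    proof -
      have "k + n > 0" "(k + 1) / 2 + n > 0" "(k + 2) / 2 + n > 0"
        using k by (auto intro!: add_pos_nonneg)
      thus ?thesis by (simp add: hyper_coeff_def pochhammer_Suc divide_simps)
    qed
    also have "(real n + 1) * (k + n) * ((k + 1) / 2 + n) * ((k + 2) / 2 + n) = ?q / 16"
      by (simp add: field_simps)
    finally have h: "?h (Suc n) * ?q = 16 * ?h n" by simp
    have "fps_nth G (2 * Suc n) * of_real ?q = - 4 * fps_nth G (2 * n)"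
      using step[of "2 * n"] by (simp add: add_ac)
    also have "\<dots> = - 4 * fps_nth G 0 * of_real (?h n) * (- 1 / 4) ^ n"
      using Suc by simp
    also have "\<dots> = (fps_nth G 0 * of_real (?h (Suc n)) * (- 1 / 4) ^ Suc n) * of_real ?q"
    proof -
      have "complex_of_real (?h (Suc n)) * of_real ?q = 16 * of_real (?h n)"
        unfolding of_real_mult [symmetric] h by simp
      thus ?thesis by (simp add: mult_ac)
    qed
    finally show ?case using pos by (simp only: mult_cancel_right of_real_eq_0_iff) auto
  qed
qed

text \<open>
  The parameters \<open>(\<nu> + 2) / 2\<close> and \<open>(\<nu> + 3) / 2\<close> come from splitting \<open>pochhammer (\<nu> + 2) (2 * n)\<close> by the
  duplication formula.
\<close>

lemma cross_entire_eq_hyper_0F: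
  assumes "\<nu> > -1"
  shows "cross_entire \<nu> w = of_real (2 * rGamma (\<nu> + 1) * rGamma (\<nu> + 2)) *
    hyper_0F [\<nu> + 1, (\<nu> + 2) / 2, (\<nu> + 3) / 2] (- w\<^sup>2 / 4)"
proof -
  define F where "F s \<mu> = Abs_fps (\<lambda>n. of_real (bessel_coeff \<mu> n) * s ^ n)" for s :: complex and \<mu>
  define A where "A = F (-1) \<nu>"
  define B where "B = F (-1) (\<nu> + 1)"
  define C where "C = F 1 \<nu>"
  define D where "D = F 1 (\<nu> + 1)"
  define G where "G = B * C + A * D"
  have F': "fps_deriv (F s \<mu>) = fps_const s * F s (\<mu> + 1)" for s \<mu>
    unfolding F_def bessel_coeff_Suc [symmetric] by (simp add: fps_eq_iff mult_ac)
  have FX: "fps_X * fps_deriv (F s (\<nu> + 1)) = F s \<nu> - fps_const (of_real (\<nu> + 1)) * F s (\<nu> + 1)" for s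
  proof (rule fps_ext)
    fix n
    show "fps_nth (fps_X * fps_deriv (F s (\<nu> + 1))) n =
        fps_nth (F s \<nu> - fps_const (of_real (\<nu> + 1)) * F s (\<nu> + 1)) n"
      unfolding F_def bessel_coeff_recurrence [of _ \<nu>, symmetric]
      by (cases n) (simp_all add: algebra_simps)
  qed
  have F_sums: "(\<lambda>n. fps_nth (F s \<mu>) n * w ^ n) sums bessel_entire \<mu> (s * w)"
    and F_summable: "summable (\<lambda>n. norm (fps_nth (F s \<mu>) n * w ^ n))" if "\<mu> > -1" for s \<mu>
    using bessel_entire_sums[OF that, of "s * w"] bessel_entire_abs_summable[OF that, of "s * w"]
    by (simp_all add: F_def power_mult_distrib mult.assoc)
  have mult_sums: "(\<lambda>n. fps_nth (F s \<mu> * F s' \<mu>') n * w ^ n) sums (bessel_entire \<mu> (s * w) * bessel_entire \<mu>' (s' * w))"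
    if "\<mu> > -1" "\<mu>' > -1" for s s' \<mu> \<mu>'
  proof -
    have "(\<Sum>i\<le>n. fps_nth (F s \<mu>) i * w ^ i * (fps_nth (F s' \<mu>') (n - i) * w ^ (n - i))) =
        fps_nth (F s \<mu> * F s' \<mu>') n * w ^ n" for n
      unfolding fps_mult_nth sum_distrib_right atLeast0AtMost
      by (intro sum.cong refl) (simp add: mult_ac flip: power_add)
    with Cauchy_product_sums[OF F_summable[OF that(1), of s] F_summable[OF that(2), of s']]
    show ?thesis using F_sums[OF that(1), of s] F_sums[OF that(2), of s'] by (simp add: sums_iff)
  qed
  have G_sums: "(\<lambda>n. fps_nth G n * w ^ n) sums cross_entire \<nu> w"
    using sums_add[OF mult_sums[of "\<nu> + 1" \<nu> "-1" 1] mult_sums[of \<nu> "\<nu> + 1" "-1" 1]] assms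
    by (simp add: G_def A_def B_def C_def D_def cross_entire_def ring_distribs)
  have k: "\<nu> + 1 > 0" using assms by simp
  have "fps_deriv A = - B" "fps_deriv C = D"
    by (simp_all add: A_def B_def C_def D_def F' fps_const_neg [symmetric] del: fps_const_neg)
  note coeffs = cross_coefficients[OF k this FX[of "-1", folded A_def B_def] FX[of 1, folded C_def D_def],
     folded G_def]
  let ?h = "hyper_coeff [\<nu> + 1, (\<nu> + 2) / 2, (\<nu> + 3) / 2]"
  have "(\<lambda>n. fps_nth G (2 * n) * w ^ (2 * n)) sums cross_entire \<nu> w"
  proof (subst sums_mono_reindex)
    show "strict_mono (\<lambda>n::nat. 2 * n)" by (simp add: strict_mono_def)
    fix n :: nat assume "n \<notin> range (\<lambda>n. 2 * n)"
    then obtain m where "n = 2 * m + 1" by (metis oddE rangeI evenE)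
    thus "fps_nth G n * w ^ n = 0" using coeffs(1)[of m] by simp
  qed (rule G_sums)
  moreover have "fps_nth G (2 * n) * w ^ (2 * n) = fps_nth G 0 * (of_real (?h n) * (- w\<^sup>2 / 4) ^ n)" for n
  proof -
    have "(- w\<^sup>2 / 4) ^ n = (- 1 / 4) ^ n * w ^ (2 * n)"
      by (simp add: power_mult flip: power_mult_distrib)
    thus ?thesis using coeffs(2)[of n] by (simp add: add_ac mult_ac)
  qed
  moreover have "(\<lambda>n. fps_nth G 0 * (of_real (?h n) * (- w\<^sup>2 / 4) ^ n)) sums
      (fps_nth G 0 * hyper_0F [\<nu> + 1, (\<nu> + 2) / 2, (\<nu> + 3) / 2] (- w\<^sup>2 / 4))"
    using assms by (intro sums_mult hyper_0F_sums) auto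
  moreover have "fps_nth G 0 = of_real (2 * rGamma (\<nu> + 1) * rGamma (\<nu> + 2))"
    by (simp add: G_def A_def B_def C_def D_def F_def bessel_coeff_def add_ac)
  ultimately show ?thesis by (simp add: sums_unique2)
qed

section \<open>Interlacing of positive zeros\<close>

text \<open>
  The function leaves its first zero with one sign and arrives at the second with the other.
\<close>

lemma same_sign_derivatives_zero:
  fixes f :: "real \<Rightarrow> real"
  assumes "x < y" "f x = 0" "f y = 0" 
    and D: "(f has_real_derivative D) (at x)" "(f has_real_derivative D') (at y)" "D * D' > 0"
    and cont: "continuous_on {x..y} f"
  shows "\<exists>z. x < z \<and> z < y \<and> f z = 0"
proof -
  have pos: "\<exists>z. x < z \<and> z < y \<and> f z = 0"
    if h: "D > 0" "D' > 0" "f x = 0" "f y = 0" "continuous_on {x..y} f"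
      "(f has_real_derivative D) (at x)" "(f has_real_derivative D') (at y)" for f D D'
  proof -
    obtain d where d: "d > 0" "\<And>h. 0 < h \<Longrightarrow> h < d \<Longrightarrow> f x < f (x + h)"
      using DERIV_pos_inc_right[OF h(6,1)] by blast
    obtain d' where d': "d' > 0" "\<And>h. 0 < h \<Longrightarrow> h < d' \<Longrightarrow> f (y - h) < f y"
      using DERIV_pos_inc_left[OF h(7,2)] by blast
    define \<delta> where "\<delta> = min (min d d') (y - x) / 2"
    have \<delta>: "0 < \<delta>" "\<delta> < d" "\<delta> < d'" "x + \<delta> \<le> y - \<delta>"
      using d(1) d'(1) \<open>x < y\<close> by (auto simp: \<delta>_def min_def)
    have "continuous_on {x + \<delta>..y - \<delta>} f"
      using \<delta> by (intro continuous_on_subset[OF h(5)]) auto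
    moreover have "f (y - \<delta>) \<le> 0" "0 \<le> f (x + \<delta>)"
      using d(2)[OF \<delta>(1,2)] d'(2)[OF \<delta>(1,3)] h(3,4) by auto
    ultimately obtain z where "x + \<delta> \<le> z" "z \<le> y - \<delta>" "f z = 0"
      using IVT2'[of f "y - \<delta>" 0 "x + \<delta>"] \<delta>(4) by auto
    thus ?thesis using \<delta>(1) by (intro exI[of _ z]) auto
  qed
  show ?thesis
  proof (cases "D > 0")
    case True
    thus ?thesis using assms pos[of D D' f] by (simp add: zero_less_mult_iff)
  next
    case False
    hence "- D > 0" "- D' > 0" using D(3) by (auto simp: zero_less_mult_iff)
    from pos[OF this, of "\<lambda>t. - f t"] show ?thesis
      using assms by (auto intro: DERIV_minus continuous_on_minus)
  qed
qed

lemma no_zero_same_sign: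
  fixes f :: "real \<Rightarrow> real"
  assumes "x < y" "continuous_on {x..y} f" "\<And>z. x \<le> z \<Longrightarrow> z \<le> y \<Longrightarrow> f z \<noteq> 0"
  shows "f x * f y > 0"
proof (rule ccontr)
  assume "\<not> f x * f y > 0"
  moreover have "f x \<noteq> 0" "f y \<noteq> 0" using assms by auto
  ultimately consider "f x < 0" "f y > 0" | "f x > 0" "f y < 0"
    by (auto simp: zero_less_mult_iff not_less)
  hence "\<exists>z\<ge>x. z \<le> y \<and> f z = 0"
    using IVT'[of f x 0 y] IVT2'[of f y 0 x] assms(1,2) by cases auto
  thus False using assms(3) by auto
qed

text \<open>
  If \<open>g\<close> had no zero in between, it would have the same sign at both ends, hence so would the
  derivative of \<open>f\<close>, and \<open>f\<close> would vanish once more.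
\<close>

lemma zero_between_consecutive_zeros:
  fixes f g :: "real \<Rightarrow> real"
  assumes "x < y" "f x = 0" "f y = 0" "\<And>z. x < z \<Longrightarrow> z < y \<Longrightarrow> f z \<noteq> 0"
    and D: "(f has_real_derivative D) (at x)" "(f has_real_derivative D') (at y)"
    and sign: "(D * g x) * (D' * g y) > 0"
    and cont: "continuous_on {x..y} f" "continuous_on {x..y} g"
  shows "\<exists>z. x < z \<and> z < y \<and> g z = 0"
proof (rule ccontr)
  assume no_zero: "\<not> ?thesis"
  have "g z \<noteq> 0" if "x \<le> z" "z \<le> y" for z
    using no_zero sign that by (cases "z = x \<or> z = y") force+
  hence "g x * g y > 0"
    using assms(1) cont(2) by (intro no_zero_same_sign)
  moreover have "(D * D') * (g x * g y) > 0" using sign by (simp add: mult_ac)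
  ultimately have "D * D' > 0" using zero_less_mult_pos2 by blast
  from same_sign_derivatives_zero[OF assms(1-3) D this cont(1)] assms(4) show False by blast
qed

lemma strict_mono_enumeration_le:
  fixes e h :: "nat \<Rightarrow> real"
  assumes "strict_mono e" "strict_mono h" "\<And>k. h k \<in> range e"
  shows "e k \<le> h k"
proof -
  have "\<forall>k. \<exists>i. h k = e i" using assms(3) by blast
  then obtain \<phi> where \<phi>: "\<And>k. h k = e (\<phi> k)" by metis
  have "strict_mono \<phi>"
    using assms(2) unfolding strict_mono_def \<phi> strict_mono_less[OF assms(1)] .
  hence "k \<le> \<phi> k" by (rule seq_suble)
  thus ?thesis using assms(1) by (simp add: \<phi> strict_mono_less_eq)
qed

text \<open>
  The sign conditions say that the curve \<open>(f, g)\<close> crosses both axes only counterclockwise. It starts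
  in the open first quadrant, so it meets the axes alternately, beginning with \<open>f = 0\<close>. For the proof
  it is enough to find zeros of \<open>g\<close> between consecutive zeros of \<open>f\<close> and conversely, and a zero of \<open>f\<close>
  before the first one of \<open>g\<close>; \<open>strict_mono_enumeration_le\<close> compares these selected zeros with the
  complete enumerations.
\<close>

lemma interlacing_zeros:
  fixes f g f' g' :: "real \<Rightarrow> real" and a b :: "nat \<Rightarrow> real"
  assumes cont: "continuous_on {0..} f" "continuous_on {0..} g"
    and start: "f 0 > 0" "g 0 > 0"
    and deriv: "\<And>t. t > 0 \<Longrightarrow> (f has_real_derivative f' t) (at t)"
      "\<And>t. t > 0 \<Longrightarrow> (g has_real_derivative g' t) (at t)"
    and f_zero: "\<And>t. t > 0 \<Longrightarrow> f t = 0 \<Longrightarrow> f' t * g t < 0"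
    and g_zero: "\<And>t. t > 0 \<Longrightarrow> g t = 0 \<Longrightarrow> g' t * f t > 0"
    and a: "strict_mono a" "range a = {t. 0 < t \<and> f t = 0}"
    and b: "strict_mono b" "range b = {t. 0 < t \<and> g t = 0}"
  shows "a i < b i" "b i < a (Suc i)"
proof -
  have a_zero: "0 < a k" "f (a k) = 0" and b_zero: "0 < b k" "g (b k) = 0" for k
    using a(2) b(2) by blast+
  have gap: "h z \<noteq> 0" if e: "strict_mono e" "range e = {t. 0 < t \<and> h t = 0}" "e k < z" "z < e (Suc k)"
    for e :: "nat \<Rightarrow> real" and h :: "real \<Rightarrow> real" and k z
  proof
    assume "h z = 0"
    moreover have "0 < e k" using e(2) by blast
    ultimately have "z \<in> range e" unfolding e(2) using e(3) by simp
    then obtain j where "z = e j" by blast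
    thus False using e(3,4) strict_mono_less[OF e(1)] by auto
  qed
  have cont': "continuous_on {x..y} f" "continuous_on {x..y} g" if "0 \<le> x" for x y
    using that by (auto intro: continuous_on_subset cont)
  have "\<exists>z. a k < z \<and> z < a (Suc k) \<and> g z = 0" for k
    using a(1) gap[OF a] a_zero f_zero deriv(1)
    by (intro zero_between_consecutive_zeros[of "a k" "a (Suc k)" f "f' (a k)" "f' (a (Suc k))"] cont'
          mult_neg_neg[of "f' (a k) * g (a k)"]) (auto simp: strict_mono_Suc_iff less_imp_le)
  then obtain h where h: "\<And>k. a k < h k" "\<And>k. h k < a (Suc k)" "\<And>k. g (h k) = 0" by metis
  have "strict_mono h" using h(1,2) by (auto simp: strict_mono_Suc_iff intro: less_trans)
  moreover have "h k \<in> range b" for k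
    unfolding b(2) using h a_zero(1) less_trans by blast
  ultimately have "b i \<le> h i" by (rule strict_mono_enumeration_le[OF b(1)])
  also have "\<dots> < a (Suc i)" by (rule h)
  finally show "b i < a (Suc i)" .

  have first: "\<exists>z. 0 < z \<and> z < b 0 \<and> f z = 0"
  proof (rule ccontr)
    assume no_zero: "\<not> ?thesis"
    have "f z \<noteq> 0" if "0 \<le> z" "z \<le> b 0" for z
      using no_zero that start(1) g_zero[OF b_zero[of 0]] by (cases "z = 0 \<or> z = b 0") auto
    hence "f 0 * f (b 0) > 0"
      using b_zero(1) by (intro no_zero_same_sign cont') auto
    hence "g' (b 0) > 0"
      using start(1) g_zero[OF b_zero[of 0]] by (simp add: zero_less_mult_iff)
    then obtain d where d: "d > 0" "\<And>h. 0 < h \<Longrightarrow> h < d \<Longrightarrow> g (b 0 - h) < g (b 0)"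
      using DERIV_pos_inc_left[OF deriv(2)[OF b_zero(1)]] by blast
    define h where "h = min d (b 0) / 2"
    have h: "0 < h" "h < d" "h < b 0" using d(1) b_zero(1)[of 0] by (auto simp: h_def)
    have "g (b 0 - h) < 0" using d(2)[OF h(1,2)] b_zero(2) by simp
    then obtain z where z: "0 \<le> z" "z \<le> b 0 - h" "g z = 0"
      using IVT2'[of g "b 0 - h" 0 0] start(2) h(3) cont'(2)[of 0] by auto
    have "z \<noteq> 0" using z(3) start(2) by auto
    hence "z \<in> range b" using z by (auto simp: b(2))
    then obtain j where "z = b j" by blast
    moreover have "b 0 \<le> b j" using b(1) by (simp add: strict_mono_less_eq)
    ultimately show False using z(2) h(1) by simp
  qed
  have next_zero: "\<exists>z. b k < z \<and> z < b (Suc k) \<and> f z = 0" for k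
    using b(1) gap[OF b] b_zero g_zero deriv(2)
    by (intro zero_between_consecutive_zeros[of "b k" "b (Suc k)" g "g' (b k)" "g' (b (Suc k))"] cont'
          mult_pos_pos[of "g' (b k) * f (b k)"]) (auto simp: strict_mono_Suc_iff less_imp_le)
  have "\<exists>z. (case k of 0 \<Rightarrow> 0 | Suc j \<Rightarrow> b j) < z \<and> z < b k \<and> f z = 0" for k
    using first next_zero by (cases k) auto
  then obtain l where l: "\<And>k. (case k of 0 \<Rightarrow> 0 | Suc j \<Rightarrow> b j) < l k" "\<And>k. l k < b k" "\<And>k. f (l k) = 0"
    by metis
  have "strict_mono l"
    unfolding strict_mono_Suc_iff
  proof
    fix k show "l k < l (Suc k)" using l(2)[of k] l(1)[of "Suc k"] by simp
  qed
  moreover have "l k \<in> range a" for k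
  proof -
    have "0 < l k" using l(1)[of k] b_zero(1)[of "k - 1"] by (cases k) auto
    thus ?thesis using l(3) by (simp add: a(2))
  qed
  ultimately have "a i \<le> l i" by (rule strict_mono_enumeration_le[OF a(1)])
  also have "\<dots> < b i" by (rule l)
  finally show "a i < b i" .
qed

lemma bessel_entire_reflected_deriv:
  fixes t :: real
  assumes "\<nu> > -1"
  shows "((\<lambda>t. bessel_entire \<nu> (- t)) has_real_derivative - bessel_entire (\<nu> + 1) (- t)) (at t)"
  using DERIV_chain2[OF bessel_entire_deriv[OF assms] DERIV_minus[OF DERIV_ident]] by simp

lemma bessel_entire_reflected_deriv_Suc:
  fixes t :: real
  assumes "\<nu> > -1" "t \<noteq> 0"
  shows "((\<lambda>t. bessel_entire (\<nu> + 1) (- t)) has_real_derivative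
     (bessel_entire \<nu> (- t) - (\<nu> + 1) * bessel_entire (\<nu> + 1) (- t)) / t) (at t)"
proof -
  have "- bessel_entire (\<nu> + 1 + 1) (- t) =
      (bessel_entire \<nu> (- t) - (\<nu> + 1) * bessel_entire (\<nu> + 1) (- t)) / t"
    using bessel_entire_recurrence[OF assms(1), of "- t"] assms(2) by (simp add: field_simps)
  thus ?thesis using bessel_entire_reflected_deriv[of "\<nu> + 1" t] assms(1) by simp
qed

text \<open>
  At a zero \<open>t > 0\<close> of the cross-product the derivative reduces to its first term. It then has the
  sign of the Bessel factor at \<open>- t\<close>, because the other factor is positive. This gives both the simplicity
  of the zeros and their interlacing.
\<close>

lemma cross_entire_deriv:
  fixes t :: real
  assumes "\<nu> > -1" "t \<noteq> 0"
  shows "(cross_entire \<nu> has_real_derivative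
     (2 * bessel_entire \<nu> (- t) * bessel_entire \<nu> t - (\<nu> + 1) * cross_entire \<nu> t) / t) (at t)"
proof -
  have D': "(bessel_entire (\<nu> + 1) has_real_derivative
      (bessel_entire \<nu> t - (\<nu> + 1) * bessel_entire (\<nu> + 1) t) / t) (at t)"
  proof -
    have "bessel_entire (\<nu> + 1 + 1) t = (bessel_entire \<nu> t - (\<nu> + 1) * bessel_entire (\<nu> + 1) t) / t"
      using bessel_entire_recurrence[OF assms(1), of t] assms(2) by (simp add: field_simps)
    thus ?thesis using bessel_entire_deriv[of "\<nu> + 1" t] assms(1) by simp
  qed
  note derivs = bessel_entire_reflected_deriv[OF assms(1)] bessel_entire_deriv[OF assms(1)]
    bessel_entire_reflected_deriv_Suc[OF assms] D'
  show ?thesis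
    unfolding cross_entire_def[abs_def]
    by (rule derivative_eq_intros derivs refl)+ (use assms(2) in \<open>simp add: field_simps\<close>)
qed

text \<open>
  The energy \<open>A\<^sup>2 + t B\<^sup>2\<close> of the solution has the derivative \<open>- (2 \<nu> + 1) B\<^sup>2\<close>, which may have either sign;
  multiplied by a high power of \<open>t\<close> it increases. If it vanished at a positive \<open>t\<close>, it would vanish on all of
  \<open>(0, t]\<close>, contrary to the positive value of \<open>A\<close> at the origin.
\<close>

lemma bessel_no_common_zero:
  fixes t :: real
  assumes "\<nu> > -1" "t > 0" "bessel_entire \<nu> (- t) = 0"
  shows "bessel_entire (\<nu> + 1) (- t) \<noteq> 0"
proof
  assume "bessel_entire (\<nu> + 1) (- t) = 0"
  define A where "A s = bessel_entire \<nu> (- s)" for s :: real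
  define B where "B s = bessel_entire (\<nu> + 1) (- s)" for s :: real
  obtain k :: nat where k: "2 * \<nu> + 1 \<le> real k" using real_arch_simple by blast
  \<comment> \<open>A power that outweighs the possibly negative derivative of the energy.\<close>
  define E where "E s = s ^ Suc k * ((A s)\<^sup>2 + s * (B s)\<^sup>2)" for s
  have A': "(A has_real_derivative - B s) (at s)" for s
    using bessel_entire_reflected_deriv[OF assms(1)] by (simp add: A_def[abs_def] B_def)
  have B': "(B has_real_derivative (A s - (\<nu> + 1) * B s) / s) (at s)" if "s \<noteq> 0" for s
    using bessel_entire_reflected_deriv_Suc[OF assms(1) that] by (simp add: A_def B_def[abs_def])
  have E': "(E has_real_derivative s ^ k * ((real k + 1) * (A s)\<^sup>2 + (real k - 2 * \<nu>) * s * (B s)\<^sup>2)) (at s)"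
    if "s > 0" for s
  proof -
    have "((\<lambda>s. (A s)\<^sup>2 + s * (B s)\<^sup>2) has_real_derivative - (2 * \<nu> + 1) * (B s)\<^sup>2) (at s)"
      using that by (auto intro!: derivative_eq_intros A' B' simp: field_simps power2_eq_square)
    from DERIV_mult[OF DERIV_pow[of "Suc k" s] this] show ?thesis
      unfolding E_def[abs_def] by (rule DERIV_cong) (simp add: algebra_simps)
  qed
  have "0 \<le> s ^ k * ((real k + 1) * (A s)\<^sup>2 + (real k - 2 * \<nu>) * s * (B s)\<^sup>2)" if "s > 0" for s
    using that k by (intro mult_nonneg_nonneg add_nonneg_nonneg) auto
  hence mono: "E s \<le> E t" if "0 < s" "s \<le> t" for s
    using that by (intro DERIV_nonneg_imp_nondecreasing[of s t E]) (meson E' order.strict_trans2)+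
  have A0: "A s = 0" if "0 < s" "s \<le> t" for s
  proof -
    have "E t = 0" using assms(3) \<open>bessel_entire (\<nu> + 1) (- t) = 0\<close> by (simp add: E_def A_def B_def)
    hence "E s \<le> 0" using mono[OF that] by simp
    hence "(A s)\<^sup>2 + s * (B s)\<^sup>2 \<le> 0"
      using zero_less_power[OF that(1), of "Suc k"] unfolding E_def mult_le_0_iff by linarith
    moreover have "0 \<le> s * (B s)\<^sup>2" using that by simp
    ultimately have "(A s)\<^sup>2 \<le> 0" by linarith
    thus ?thesis by simp
  qed
  have "A 0 > 0" using bessel_entire_pos[OF assms(1), of 0] by (simp add: A_def)
  moreover have lim: "(A \<longlongrightarrow> A 0) (at_right 0)"
    using DERIV_isCont[OF A', of 0] tendsto_within_subset[of A "nhds (A 0)" 0 UNIV "{0<..}"]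
    by (simp add: isCont_def)
  have "(A \<longlongrightarrow> 0) (at_right 0)"
  proof (rule tendsto_eventually)
    show "eventually (\<lambda>s. A s = 0) (at_right 0)"
      using assms(2) A0 by (auto simp: eventually_at_right_field intro!: exI[of _ t])
  qed
  from tendsto_unique[OF trivial_limit_at_right_real lim this] have "A 0 = 0" .
  ultimately show False by simp
qed

section \<open>From the entire series to the Bessel functions\<close>

lemma bessel_entire_zeros:
  assumes "\<nu> > -1"
  shows "\<exists>a :: nat \<Rightarrow> real. strict_mono a \<and> range a = {t. 0 < t \<and> bessel_entire \<nu> (- t) = 0}"
proof -
  define c where "c = rGamma (\<nu> + 1)"
  have "c > 0" using assms Gamma_real_pos[of "\<nu> + 1"] by (simp add: c_def rGamma_inverse_Gamma)
  have hyper: "hyper_0F [\<nu> + 1] (- of_real t) = of_real (bessel_entire \<nu> (- t) / c)" for t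
    using bessel_entire_of_real[OF assms, of "- t", where ?'b = complex]
      bessel_entire_eq_hyper_0F[OF assms, of "- of_real t"] \<open>c > 0\<close>
    by (simp add: c_def field_simps)
  have deriv: "((\<lambda>t. bessel_entire \<nu> (- t) / c) has_real_derivative - bessel_entire (\<nu> + 1) (- t) / c) (at t)" for t
    using DERIV_cdivide[OF bessel_entire_reflected_deriv[OF assms]] by simp
  have "\<exists>e :: nat \<Rightarrow> real. (\<forall>i. 0 < e i) \<and> strict_mono e \<and>
    range e = {x. 0 < x \<and> hyper_0F [\<nu> + 1] (- of_real x) = 0} \<and>
    (\<forall>z. (\<lambda>i. 1 - z / of_real (e i)) has_prod hyper_0F [\<nu> + 1] (- z))"
  proof (rule hyper_0F_simple_zeros)
    fix x :: real
    assume "0 < x" "hyper_0F [\<nu> + 1] (- of_real x) = 0"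
    hence "bessel_entire (\<nu> + 1) (- x) \<noteq> 0"
      using bessel_no_common_zero[OF assms] \<open>c > 0\<close> by (simp add: hyper)
    thus "\<exists>D. D \<noteq> 0 \<and> ((\<lambda>t. Re (hyper_0F [\<nu> + 1] (- of_real t))) has_real_derivative D) (at x)"
      using deriv[of x] \<open>c > 0\<close>
      by (intro exI[of _ "- bessel_entire (\<nu> + 1) (- x) / c"]) (simp add: hyper)
  qed (use assms in auto)
  thus ?thesis using \<open>c > 0\<close> by (auto simp: hyper)
qed

lemma isCont_bessel_entire [continuous_intros]:
  fixes f :: "'b :: t2_space \<Rightarrow> 'a :: {real_normed_field, banach}"
  assumes "\<nu> > -1" "continuous (at x) f"
  shows "continuous (at x) (\<lambda>x. bessel_entire \<nu> (f x))"
  using DERIV_isCont[OF bessel_entire_deriv[OF assms(1)]] assms(2) by (rule isCont_o2[rotated])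

lemma isCont_cross_entire:
  fixes w :: "'a :: {real_normed_field, banach}"
  assumes "\<nu> > -1"
  shows "isCont (cross_entire \<nu>) w"
  unfolding cross_entire_def[abs_def] using assms by (intro continuous_intros) auto

lemma cross_entire_of_real:
  fixes t :: real
  assumes "\<nu> > -1"
  shows "cross_entire \<nu> (of_real t :: complex) = of_real (cross_entire \<nu> t)"
proof -
  have "bessel_entire \<mu> (- of_real t :: complex) = of_real (bessel_entire \<mu> (- t))"
    "bessel_entire \<mu> (of_real t :: complex) = of_real (bessel_entire \<mu> t)" if "\<mu> > -1" for \<mu>
    using bessel_entire_of_real[OF that, of "- t", where ?'b = complex] bessel_entire_of_real[OF that] by simp_all
  thus ?thesis using assms by (simp add: cross_entire_def)
qed

text \<open>
  At a zero of the cross-product the two terms \<open>B C\<close> and \<open>A D\<close> are opposite, and the values \<open>C\<close>, \<open>D\<close> at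
  the positive argument are positive. Thus \<open>A\<close> and \<open>B\<close> have opposite signs or vanish together, and
  \<open>bessel_no_common_zero\<close> excludes the latter.
\<close>

lemma cross_zero_signs:
  fixes t :: real
  assumes "\<nu> > -1" "t > 0" "cross_entire \<nu> t = 0"
  shows "bessel_entire \<nu> (- t) \<noteq> 0"
    "bessel_entire \<nu> (- t) * bessel_entire (\<nu> + 1) (- t) < 0"
proof -
  let ?A = "bessel_entire \<nu> (- t)" and ?B = "bessel_entire (\<nu> + 1) (- t)"
  let ?C = "bessel_entire \<nu> t" and ?D = "bessel_entire (\<nu> + 1) t"
  have pos: "?C > 0" "?D > 0" using assms by (auto intro!: bessel_entire_pos)
  have eq: "?B * ?C = - ?A * ?D" using assms(3) by (simp add: cross_entire_def)
  show nz: "?A \<noteq> 0" using bessel_no_common_zero[OF assms(1,2)] eq pos by auto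
  have "(?A * ?B) * ?C = - ?A\<^sup>2 * ?D"
    using arg_cong[OF eq, of "\<lambda>x. ?A * x"] by (simp add: power2_eq_square mult.assoc)
  also have "\<dots> < 0" using nz pos by simp
  finally show "?A * ?B < 0" using pos by (simp add: mult_less_0_iff)
qed

lemma cross_entire_deriv_at_zero:
  fixes t :: real
  assumes "\<nu> > -1" "t > 0" "cross_entire \<nu> t = 0"
  shows "(cross_entire \<nu> has_real_derivative 2 * bessel_entire \<nu> (- t) * bessel_entire \<nu> t / t) (at t)"
  using cross_entire_deriv[OF assms(1), of t] assms(2,3) by simp

text \<open>
  The product formula is in the variable \<open>x = t\<^sup>2 / 4\<close>, so a zero \<open>e\<close> in \<open>x\<close> is the zero \<open>2 sqrt e\<close> in \<open>t\<close>.
  The simplicity of the zeros is carried over to \<open>x\<close> by the chain rule.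
\<close>

lemma cross_entire_factorization:
  assumes "\<nu> > -1"
  defines "f \<equiv> hyper_0F [\<nu> + 1, (\<nu> + 2) / 2, (\<nu> + 3) / 2]"
  shows "\<exists>b :: nat \<Rightarrow> real. strict_mono b \<and> range b = {t. 0 < t \<and> cross_entire \<nu> t = 0} \<and>
    (\<forall>z. (\<lambda>i. 1 - z\<^sup>2 / (of_real (b i))\<^sup>2) has_prod f (- z\<^sup>2 / 4))"
proof -
  define c where "c = 2 * rGamma (\<nu> + 1) * rGamma (\<nu> + 2)"
  have "c > 0" using assms Gamma_real_pos[of "\<nu> + 1"] Gamma_real_pos[of "\<nu> + 2"]
    by (simp add: c_def rGamma_inverse_Gamma)
  have hyper: "f (- of_real x) = of_real (cross_entire \<nu> (2 * sqrt x) / c)" if "x \<ge> 0" for x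
  proof -
    have "(2 * complex_of_real (sqrt x))\<^sup>2 / 4 = of_real x"
      using that by (simp add: power_mult_distrib flip: of_real_power)
    hence "of_real (cross_entire \<nu> (2 * sqrt x)) = of_real c * f (- of_real x)"
      using cross_entire_eq_hyper_0F[OF assms(1), of "of_real (2 * sqrt x)", folded c_def f_def]
        cross_entire_of_real[OF assms(1), of "2 * sqrt x"] by simp
    thus ?thesis using \<open>c > 0\<close> by simp
  qed
  have "\<exists>e :: nat \<Rightarrow> real. (\<forall>i. 0 < e i) \<and> strict_mono e \<and>
    range e = {x. 0 < x \<and> f (- of_real x) = 0} \<and>
    (\<forall>z. (\<lambda>i. 1 - z / of_real (e i)) has_prod f (- z))"
    unfolding f_def
  proof (rule hyper_0F_simple_zeros, unfold f_def [symmetric])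
    fix x :: real
    assume x: "0 < x" "f (- of_real x) = 0"
    let ?t = "2 * sqrt x"
    have t: "?t > 0" "cross_entire \<nu> ?t = 0"
      using x hyper[of x] \<open>c > 0\<close> by auto
    define D where "D = 2 * bessel_entire \<nu> (- ?t) * bessel_entire \<nu> ?t / ?t * (1 / sqrt x) / c"
    have "D \<noteq> 0"
      using cross_zero_signs(1)[OF assms(1) t] bessel_entire_pos[OF assms(1), of ?t] x(1) \<open>c > 0\<close>
      by (simp add: D_def)
    moreover have "((\<lambda>t. cross_entire \<nu> (2 * sqrt t) / c) has_real_derivative D) (at x)"
    proof -
      have "((\<lambda>t. 2 * sqrt t) has_real_derivative 1 / sqrt x) (at x)"
        using x(1) by (auto intro!: derivative_eq_intros simp: field_simps)
      from DERIV_chain2[where f = "cross_entire \<nu>" and g = "\<lambda>t. 2 * sqrt t" and x = x,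
          OF cross_entire_deriv_at_zero[OF assms(1) t] this]
      show ?thesis unfolding D_def by (rule DERIV_cdivide)
    qed
    hence "((\<lambda>t. Re (f (- of_real t))) has_real_derivative D) (at x)"
    proof (rule has_field_derivative_transform_within_open[of _ _ _ "{0<..}"])
      fix t :: real assume "t \<in> {0<..}"
      thus "cross_entire \<nu> (2 * sqrt t) / c = Re (f (- of_real t))" using hyper[of t] by simp
    qed (use x in auto)
    ultimately show "\<exists>D. D \<noteq> 0 \<and> ((\<lambda>t. Re (f (- of_real t))) has_real_derivative D) (at x)" by blast
  qed (use assms in auto)
  then obtain e :: "nat \<Rightarrow> real" where e: "\<And>i. 0 < e i" "strict_mono e"
    "range e = {x. 0 < x \<and> f (- of_real x) = 0}"
    "\<And>z. (\<lambda>i. 1 - z / of_real (e i)) has_prod f (- z)" by auto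
  define b where "b i = 2 * sqrt (e i)" for i
  have "strict_mono b" using e(2) by (simp add: b_def strict_mono_def)
  moreover have "range b = {t. 0 < t \<and> cross_entire \<nu> t = 0}"
  proof (intro equalityI subsetI)
    fix t assume "t \<in> range b"
    then obtain i where t: "t = 2 * sqrt (e i)" by (auto simp: b_def)
    have "f (- of_real (e i)) = 0" using e(3) by blast
    thus "t \<in> {t. 0 < t \<and> cross_entire \<nu> t = 0}"
      using e(1)[of i] hyper[of "e i"] \<open>c > 0\<close> by (simp add: t)
  next
    fix t :: real assume t: "t \<in> {t. 0 < t \<and> cross_entire \<nu> t = 0}"
    hence "2 * sqrt ((t / 2)\<^sup>2) = t" by simp
    hence "(t / 2)\<^sup>2 \<in> range e"
      using t hyper[of "(t / 2)\<^sup>2"] unfolding e(3) by simp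
    then obtain i where "(t / 2)\<^sup>2 = e i" by blast
    hence "t = b i" using \<open>2 * sqrt ((t / 2)\<^sup>2) = t\<close> by (simp add: b_def)
    thus "t \<in> range b" by blast
  qed
  moreover have "(\<lambda>i. 1 - z\<^sup>2 / (of_real (b i))\<^sup>2) has_prod f (- z\<^sup>2 / 4)" for z :: complex
  proof -
    have "(z\<^sup>2 / 4) / of_real (e i) = z\<^sup>2 / (of_real (b i))\<^sup>2" for i
      using e(1)[of i] by (simp add: b_def power_mult_distrib flip: of_real_power)
    hence "(\<lambda>i. 1 - z\<^sup>2 / (of_real (b i))\<^sup>2) = (\<lambda>i. 1 - (z\<^sup>2 / 4) / of_real (e i))"
      by (simp only:)
    thus ?thesis using e(4)[of "z\<^sup>2 / 4"] by (simp only: minus_divide_left)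
  qed
  ultimately show ?thesis by (intro exI[of _ b]) auto
qed

lemma nth_pos_zero_enumeration:
  assumes "strict_mono e" "range e = {y. 0 < y \<and> f (complex_of_real y) = 0}"
  shows "nth_pos_zero f (Suc i) = e i"
proof (rule nth_pos_zero_eqI)
  have "e i \<in> range e" by blast
  thus "0 < e i" "f (complex_of_real (e i)) = 0" unfolding assms(2) by auto
  have "{y. 0 < y \<and> y \<le> e i \<and> f (complex_of_real y) = 0} = {y \<in> range e. y \<le> e i}"
    unfolding assms(2) by auto
  also have "\<dots> = e ` {..i}" using strict_mono_less_eq[OF assms(1)] by auto
  also have "card \<dots> = Suc i"
    using strict_mono_imp_inj_on[OF assms(1)] by (simp add: card_image inj_on_subset)
  finally show "card {y. 0 < y \<and> y \<le> e i \<and> f (complex_of_real y) = 0} = Suc i" .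
qed simp

lemma bessel_J_eq: "bessel_J \<nu> z = bessel_pow \<nu> z * bessel_entire \<nu> (- ((z / 2)\<^sup>2))"
proof -
  have "(- 1) ^ k * of_real (rGamma (\<nu> + real k + 1)) / fact k * (z / 2) ^ (2 * k) =
      of_real (bessel_coeff \<nu> k) * (- ((z / 2)\<^sup>2)) ^ k" for k
    by (subst power_minus) (simp add: bessel_coeff_def power_mult)
  thus ?thesis by (simp only: bessel_J_def bessel_entire_def)
qed

lemma bessel_I_eq: "bessel_I \<nu> z = bessel_pow \<nu> z * bessel_entire \<nu> ((z / 2)\<^sup>2)"
proof -
  have "of_real (rGamma (\<nu> + real k + 1)) / fact k * (z / 2) ^ (2 * k) =
      of_real (bessel_coeff \<nu> k) * ((z / 2)\<^sup>2) ^ k" for k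
    by (simp add: bessel_coeff_def power_mult)
  thus ?thesis by (simp only: bessel_I_def bessel_entire_def)
qed

lemma bessel_cross_eq:
  "bessel_cross \<nu> z = bessel_pow \<nu> z * bessel_pow (\<nu> + 1) z * cross_entire \<nu> ((z / 2)\<^sup>2)"
  by (simp add: bessel_cross_def bessel_J_eq bessel_I_eq cross_entire_def algebra_simps)

lemma bessel_pow_eq: "z \<noteq> 0 \<Longrightarrow> bessel_pow \<nu> z = (z / 2) powr of_real \<nu>"
  by (simp add: bessel_pow_def)

text \<open>
  As \<open>Ln (z / 2) = Ln z - ln 2\<close> also on the branch cut, the principal powers cancel up to the positive
  constant \<open>2 powr (2 \<nu>) * 2 powr (- 2 \<nu> - 1) = 1 / 2\<close>.
\<close>

lemma bessel_cross_normalized_nonzero: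
  assumes "\<nu> > -1" "z \<noteq> 0"
  shows "of_real (2 powr (2 * \<nu>)) * z powr of_real (- 2 * \<nu> - 1) *
      of_real (Gamma (\<nu> + 1) * Gamma (\<nu> + 2)) * bessel_cross \<nu> z =
    hyper_0F [\<nu> + 1, (\<nu> + 2) / 2, (\<nu> + 3) / 2] (- (z ^ 4) / 64)"
proof -
  define s where "s = 2 * \<nu> + 1"
  let ?H = "hyper_0F [\<nu> + 1, (\<nu> + 2) / 2, (\<nu> + 3) / 2] (- (z ^ 4) / 64)"
  have "bessel_pow \<nu> z * bessel_pow (\<nu> + 1) z = (z / 2) powr of_real s"
    using assms(2) unfolding bessel_pow_eq[OF assms(2)] powr_add [symmetric] by (simp add: s_def)
  also have "\<dots> = z powr of_real s * of_real (2 powr (- s))"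
  proof -
    have "Ln (z / of_real 2) = Ln z - of_real (ln 2)"
      using assms(2) by (intro Ln_divide_of_real) auto
    hence "Ln (z / 2) = Ln z - of_real (ln 2)" by simp
    hence "(z / 2) powr of_real s = exp (of_real s * (Ln z - of_real (ln 2)))"
      using assms(2) by (simp add: powr_def)
    also have "\<dots> = exp (of_real s * Ln z) * exp (of_real (- s * ln 2))"
      by (simp add: right_diff_distrib exp_diff exp_minus divide_inverse)
    also have "\<dots> = z powr of_real s * of_real (2 powr (- s))"
      using assms(2) by (simp only: powr_def exp_of_real) simp
    finally show ?thesis .
  qed
  finally have pow: "bessel_pow \<nu> z * bessel_pow (\<nu> + 1) z = z powr of_real s * of_real (2 powr (- s))" .
  have pow_inverse: "z powr of_real (- 2 * \<nu> - 1) * z powr of_real s = 1"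
    using assms(2) by (simp add: s_def flip: powr_add)
  have pow_2: "2 powr (2 * \<nu>) * 2 powr (- s) = 1 / 2"
    by (simp add: s_def powr_minus_divide flip: powr_add)
  have cross: "cross_entire \<nu> ((z / 2)\<^sup>2) = of_real (2 * rGamma (\<nu> + 1) * rGamma (\<nu> + 2)) * ?H"
    using cross_entire_eq_hyper_0F[OF assms(1), of "(z / 2)\<^sup>2"] by (simp add: power_divide)
  have Gamma: "Gamma (\<nu> + 1) * Gamma (\<nu> + 2) * (2 * rGamma (\<nu> + 1) * rGamma (\<nu> + 2)) = 2"
  proof -
    have "Gamma (\<nu> + 1) > 0" "Gamma (\<nu> + 2) > 0"
      using assms(1) by (intro Gamma_real_pos; simp)+
    thus ?thesis by (simp add: rGamma_inverse_Gamma field_simps)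
  qed
  have "of_real (2 powr (2 * \<nu>)) * z powr of_real (- 2 * \<nu> - 1) *
      of_real (Gamma (\<nu> + 1) * Gamma (\<nu> + 2)) * bessel_cross \<nu> z =
      (z powr of_real (- 2 * \<nu> - 1) * z powr of_real s) * of_real (2 powr (2 * \<nu>) * 2 powr (- s)) *
      of_real (Gamma (\<nu> + 1) * Gamma (\<nu> + 2) * (2 * rGamma (\<nu> + 1) * rGamma (\<nu> + 2))) * ?H"
    by (simp only: bessel_cross_eq pow cross of_real_mult mult_ac)
  also have "\<dots> = ?H"
    unfolding pow_inverse pow_2 Gamma by simp
  finally show ?thesis .
qed

lemma bessel_cross_normalized_eq:
  assumes "\<nu> > -1"
  shows "bessel_cross_normalized \<nu> z = hyper_0F [\<nu> + 1, (\<nu> + 2) / 2, (\<nu> + 3) / 2] (- (z ^ 4) / 64)"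
proof (cases "z = 0")
  case False
  thus ?thesis
    using bessel_cross_normalized_nonzero[OF assms False] by (simp only: bessel_cross_normalized_def Let_def if_False)
next
  case True
  let ?f = "hyper_0F [\<nu> + 1, (\<nu> + 2) / 2, (\<nu> + 3) / 2]"
  let ?g = "\<lambda>w. of_real (2 powr (2 * \<nu>)) * w powr of_real (- 2 * \<nu> - 1) *
                   of_real (Gamma (\<nu> + 1) * Gamma (\<nu> + 2)) * bessel_cross \<nu> w"
  define c where "c = 2 * rGamma (\<nu> + 1) * rGamma (\<nu> + 2)"
  have "c > 0" using assms Gamma_real_pos[of "\<nu> + 1"] Gamma_real_pos[of "\<nu> + 2"]
    by (simp add: c_def rGamma_inverse_Gamma)
  have f: "?f (- (w ^ 4) / 64) = cross_entire \<nu> ((w / 2)\<^sup>2) / of_real c" for w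
    using cross_entire_eq_hyper_0F[OF assms, of "(w / 2)\<^sup>2", folded c_def] \<open>c > 0\<close>
    by (simp add: power_divide)
  have "isCont (\<lambda>w. cross_entire \<nu> ((w / 2)\<^sup>2) / of_real c) 0"
    using \<open>c > 0\<close> by (intro continuous_intros isCont_o2[OF _ isCont_cross_entire[OF assms]]) auto
  hence "((\<lambda>w. ?f (- (w ^ 4) / 64)) \<longlongrightarrow> ?f (- (0 ^ 4) / 64)) (at 0)"
    unfolding f isCont_def .
  moreover have "eventually (\<lambda>w. ?f (- (w ^ 4) / 64) = ?g w) (at 0)"
    using eventually_neq_at_within[of 0 0 UNIV]
    by eventually_elim (rule bessel_cross_normalized_nonzero[OF assms, symmetric])
  ultimately have "(?g \<longlongrightarrow> ?f (- (0 ^ 4) / 64)) (at 0)" by (rule Lim_transform_eventually)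
  hence "Lim (at 0) ?g = ?f (- (0 ^ 4) / 64)" by (intro tendsto_Lim) auto
  thus ?thesis using True by (simp only: bessel_cross_normalized_def Let_def simp_thms if_True)
qed

text \<open>
  A zero \<open>y\<close> of a Bessel function or of the cross-product corresponds to the zero \<open>(y / 2)\<^sup>2\<close> of its
  entire part, and this correspondence preserves the order.
\<close>

lemma scaled_square_enumeration:
  fixes a :: "nat \<Rightarrow> real"
  assumes "strict_mono a" "range a = {t. 0 < t \<and> h t = 0}"
    and "\<And>y. y > 0 \<Longrightarrow> f (complex_of_real y) = 0 \<longleftrightarrow> h ((y / 2)\<^sup>2) = (0 :: real)"
  shows "nth_pos_zero f (Suc i) = 2 * sqrt (a i)"
proof (rule nth_pos_zero_enumeration[of "\<lambda>i. 2 * sqrt (a i)"])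
  show "strict_mono (\<lambda>i. 2 * sqrt (a i))" using assms(1) by (simp add: strict_mono_def)
  show "range (\<lambda>i. 2 * sqrt (a i)) = {y. 0 < y \<and> f (complex_of_real y) = 0}"
  proof (intro equalityI subsetI)
    fix y assume "y \<in> range (\<lambda>i. 2 * sqrt (a i))"
    then obtain i where y: "y = 2 * sqrt (a i)" by blast
    have "0 < a i" "h (a i) = 0" using assms(2) by blast+
    thus "y \<in> {y. 0 < y \<and> f (complex_of_real y) = 0}"
      using assms(3)[of y] by (simp add: y)
  next
    fix y assume y: "y \<in> {y. 0 < y \<and> f (complex_of_real y) = 0}"
    hence "(y / 2)\<^sup>2 \<in> range a" using assms(3)[of y] by (simp add: assms(2))
    then obtain i where "(y / 2)\<^sup>2 = a i" by blast
    hence "2 * sqrt (a i) = y" using y by (simp flip: \<open>(y / 2)\<^sup>2 = a i\<close>)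
    thus "y \<in> range (\<lambda>i. 2 * sqrt (a i))" by blast
  qed
qed

lemma bessel_zero_eq:
  fixes a :: "nat \<Rightarrow> real"
  assumes "\<nu> > -1" "strict_mono a" "range a = {t. 0 < t \<and> bessel_entire \<nu> (- t) = 0}"
  shows "bessel_zero \<nu> (Suc i) = 2 * sqrt (a i)"
proof (rule scaled_square_enumeration[OF assms(2,3)])
  fix y :: real assume "y > 0"
  have "bessel_entire \<nu> (- ((complex_of_real y / 2)\<^sup>2)) = of_real (bessel_entire \<nu> (- ((y / 2)\<^sup>2)))"
    using bessel_entire_of_real[OF assms(1), of "- ((y / 2)\<^sup>2)", where ?'b = complex] by simp
  thus "bessel_J \<nu> (of_real y) = 0 \<longleftrightarrow> bessel_entire \<nu> (- ((y / 2)\<^sup>2)) = 0"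
    using \<open>y > 0\<close> by (simp add: bessel_J_eq bessel_pow_eq)
qed

lemma cross_zero_eq:
  fixes b :: "nat \<Rightarrow> real"
  assumes "\<nu> > -1" "strict_mono b" "range b = {t. 0 < t \<and> cross_entire \<nu> t = 0}"
  shows "cross_zero \<nu> (Suc i) = 2 * sqrt (b i)"
proof (rule scaled_square_enumeration[OF assms(2,3)])
  fix y :: real assume "y > 0"
  have "cross_entire \<nu> ((complex_of_real y / 2)\<^sup>2) = of_real (cross_entire \<nu> ((y / 2)\<^sup>2))"
    using cross_entire_of_real[OF assms(1), of "(y / 2)\<^sup>2"] by simp
  thus "bessel_cross \<nu> (of_real y) = 0 \<longleftrightarrow> cross_entire \<nu> ((y / 2)\<^sup>2) = 0"
    using \<open>y > 0\<close> by (simp add: bessel_cross_eq bessel_pow_eq)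
qed

text \<open>
  With \<open>A\<close>, \<open>B\<close> at \<open>- t\<close> and \<open>C\<close>, \<open>D > 0\<close> at \<open>t\<close>, the cross-product is \<open>G = B C + A D\<close>. Here \<open>A' = - B\<close>;
  at zeros of \<open>B\<close> and \<open>G\<close> the derivatives are \<open>B' = A / t\<close> and \<open>G' = 2 A C / t\<close>. The pairs \<open>(A, G)\<close> and
  \<open>(G, B)\<close> therefore both satisfy the sign conditions of \<open>interlacing_zeros\<close>.
\<close>

lemma cross_interlacing:
  fixes a a' b :: "nat \<Rightarrow> real"
  assumes \<nu>: "\<nu> > -1"
    and a: "strict_mono a" "range a = {t. 0 < t \<and> bessel_entire \<nu> (- t) = 0}"
    and a': "strict_mono a'" "range a' = {t. 0 < t \<and> bessel_entire (\<nu> + 1) (- t) = 0}"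
    and b: "strict_mono b" "range b = {t. 0 < t \<and> cross_entire \<nu> t = 0}"
  shows "a i < b i" "b i < a (Suc i)" "b i < a' i"
proof -
  define A where "A t = bessel_entire \<nu> (- t)" for t :: real
  define B where "B t = bessel_entire (\<nu> + 1) (- t)" for t :: real
  define C where "C t = bessel_entire \<nu> t" for t :: real
  define D where "D t = bessel_entire (\<nu> + 1) t" for t :: real
  define G where "G t = cross_entire \<nu> t" for t :: real
  have G: "G t = B t * C t + A t * D t" for t
    by (simp add: A_def B_def C_def D_def G_def cross_entire_def)
  have pos: "C t > 0" "D t > 0" if "t \<ge> 0" for t
    using \<nu> that by (auto simp: C_def D_def intro!: bessel_entire_pos)
  have A0: "A 0 > 0" "B 0 > 0" using pos[of 0] by (simp_all add: A_def B_def C_def D_def)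
  hence G0: "G 0 > 0" using pos[of 0] by (simp add: G add_pos_pos)
  have cont: "continuous_on {0..} A" "continuous_on {0..} B" "continuous_on {0..} G"
    using \<nu> isCont_cross_entire[OF \<nu>]
    by (auto intro!: continuous_at_imp_continuous_on continuous_intros simp: A_def[abs_def] B_def[abs_def] G_def[abs_def])
  have A': "(A has_real_derivative - B t) (at t)" for t
    using bessel_entire_reflected_deriv[OF \<nu>] by (simp add: A_def[abs_def] B_def)
  have B': "(B has_real_derivative (A t - (\<nu> + 1) * B t) / t) (at t)" if "t > 0" for t
    using bessel_entire_reflected_deriv_Suc[OF \<nu>, of t] that by (simp add: A_def B_def[abs_def])
  have G': "(G has_real_derivative (2 * A t * C t - (\<nu> + 1) * G t) / t) (at t)" if "t > 0" for t
    using cross_entire_deriv[OF \<nu>, of t] that by (simp add: A_def C_def G_def[abs_def])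
  have AB: "B t \<noteq> 0" if "t > 0" "A t = 0" for t
    using bessel_no_common_zero[OF \<nu>] that by (simp add: A_def B_def)
  have G_zero: "A t \<noteq> 0" "A t * B t < 0" if "t > 0" "G t = 0" for t
    using cross_zero_signs[OF \<nu>] that by (simp_all add: A_def B_def G_def)
  have a2: "range a = {t. 0 < t \<and> A t = 0}" and b2: "range b = {t. 0 < t \<and> G t = 0}"
    and a'2: "range a' = {t. 0 < t \<and> B t = 0}"
    using a(2) a'(2) b(2) by (simp_all add: A_def B_def G_def)
  have A_zero_sign: "- B t * G t < 0" if "t > 0" "A t = 0" for t
  proof -
    have "B t * G t = (B t)\<^sup>2 * C t" using that by (simp add: G power2_eq_square)
    thus ?thesis using AB[OF that] pos[of t] that by simp
  qed
  have G_zero_sign: "(2 * A t * C t - (\<nu> + 1) * G t) / t * A t > 0" if "t > 0" "G t = 0" for t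
  proof -
    have "(2 * A t * C t - (\<nu> + 1) * G t) / t * A t = 2 * (A t)\<^sup>2 * C t / t"
      using that by (simp add: power2_eq_square)
    moreover have "0 < 2 * (A t)\<^sup>2 * C t / t"
      using G_zero(1)[OF that] pos[of t] that by simp
    ultimately show ?thesis by (simp only:)
  qed
  show "a i < b i"
    by (rule interlacing_zeros(1)[of A G "\<lambda>t. - B t" "\<lambda>t. (2 * A t * C t - (\<nu> + 1) * G t) / t" a b];
      (rule cont A0 G0 A' G' A_zero_sign G_zero_sign a a2 b b2; assumption))
  show "b i < a (Suc i)"
    by (rule interlacing_zeros(2)[of A G "\<lambda>t. - B t" "\<lambda>t. (2 * A t * C t - (\<nu> + 1) * G t) / t" a b];
      (rule cont A0 G0 A' G' A_zero_sign G_zero_sign a a2 b b2; assumption))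
  have G_zero_sign': "(2 * A t * C t - (\<nu> + 1) * G t) / t * B t < 0" if "t > 0" "G t = 0" for t
  proof -
    have "(2 * A t * C t - (\<nu> + 1) * G t) / t * B t = (2 * C t / t) * (A t * B t)"
      using that by simp
    moreover have "2 * C t / t > 0" using pos[of t] that by simp
    ultimately show ?thesis using mult_pos_neg[OF _ G_zero(2)[OF that]] by (simp only:)
  qed
  have B_zero_sign: "(A t - (\<nu> + 1) * B t) / t * G t > 0" if "t > 0" "B t = 0" for t
  proof -
    have "(A t - (\<nu> + 1) * B t) / t * G t = (A t)\<^sup>2 * D t / t"
      using that by (simp add: G power2_eq_square)
    moreover have "A t \<noteq> 0" using AB[of t] that by auto
    hence "(A t)\<^sup>2 * D t / t > 0" using pos[of t] that by simp
    ultimately show ?thesis by (simp only:)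
  qed
  show "b i < a' i"
    by (rule interlacing_zeros(1)[of G B "\<lambda>t. (2 * A t * C t - (\<nu> + 1) * G t) / t"
        "\<lambda>t. (A t - (\<nu> + 1) * B t) / t" b a'];
      (rule cont A0 G0 G' B' G_zero_sign' B_zero_sign a' a'2 b b2; assumption))
qed

theorem lemma3:
  fixes \<nu> :: real
  assumes "\<nu> > - 1"
  shows "(\<forall>z :: complex.
            (\<lambda>n. 1 - z ^ 4 / of_real (cross_zero \<nu> (Suc n)) ^ 4) has_prod
              bessel_cross_normalized \<nu> z) \<and>
         (\<forall>n\<ge>1. bessel_zero \<nu> n < cross_zero \<nu> n \<and>
                cross_zero \<nu> n < bessel_zero \<nu> (n + 1) \<and>
                cross_zero \<nu> n < bessel_zero (\<nu> + 1) n)"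
proof -
  from assms have \<nu>': "\<nu> + 1 > -1" by simp
  from bessel_entire_zeros[OF assms]
  obtain a :: "nat \<Rightarrow> real" where a: "strict_mono a" "range a = {t. 0 < t \<and> bessel_entire \<nu> (- t) = 0}"
    by auto
  from bessel_entire_zeros[OF \<nu>']
  obtain a' :: "nat \<Rightarrow> real" where a': "strict_mono a'" "range a' = {t. 0 < t \<and> bessel_entire (\<nu> + 1) (- t) = 0}"
    by auto
  from cross_entire_factorization[OF assms] obtain b :: "nat \<Rightarrow> real" where
    b: "strict_mono b" "range b = {t. 0 < t \<and> cross_entire \<nu> t = 0}" and
    prod: "\<And>z. (\<lambda>i. 1 - z\<^sup>2 / (of_real (b i))\<^sup>2) has_prod
       hyper_0F [\<nu> + 1, (\<nu> + 2) / 2, (\<nu> + 3) / 2] (- z\<^sup>2 / 4)" by auto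
  have b_pos: "0 < b i" for i using b(2) by blast
  show ?thesis
  proof (intro conjI allI impI)
    fix z :: complex
    have factor: "((z / 2)\<^sup>2)\<^sup>2 / (of_real (b i))\<^sup>2 = z ^ 4 / of_real (cross_zero \<nu> (Suc i)) ^ 4" for i
    proof -
      have "(sqrt (b i)) ^ 4 = (b i)\<^sup>2"
        using b_pos[of i] power_mult[of "sqrt (b i)" 2 2] by simp
      hence "cross_zero \<nu> (Suc i) ^ 4 = 16 * (b i)\<^sup>2"
        by (simp add: cross_zero_eq[OF assms b] power_mult_distrib)
      thus ?thesis by (simp add: power_divide flip: of_real_power)
    qed
    have arg: "- ((z / 2)\<^sup>2)\<^sup>2 / 4 = - (z ^ 4) / 64" by (simp add: power_divide)
    show "(\<lambda>n. 1 - z ^ 4 / of_real (cross_zero \<nu> (Suc n)) ^ 4) has_prod bessel_cross_normalized \<nu> z"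
      using prod[of "(z / 2)\<^sup>2"] unfolding factor arg bessel_cross_normalized_eq[OF assms] .
  next
    fix n :: nat assume "n \<ge> 1"
    then obtain i where n: "n = Suc i" by (cases n) auto
    note interlacing = cross_interlacing[OF assms a a' b, of i]
    show "bessel_zero \<nu> n < cross_zero \<nu> n" "cross_zero \<nu> n < bessel_zero \<nu> (n + 1)"
      "cross_zero \<nu> n < bessel_zero (\<nu> + 1) n"
      using interlacing
      by (simp_all add: n bessel_zero_eq[OF assms a] bessel_zero_eq[OF \<nu>' a'] cross_zero_eq[OF assms b])
  qed
qed

end
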